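(* For every integer $k\ge 1$, there exist a positive integer $n$, an element $g\in \mathsf{S}_n$, and an irreducible complex character $\chi$ of $\mathsf{S}_n$ such that $g$ has exactly $k$ orbits on $\{1,\ldots,n\}$ and $|\chi(g)|=k!$.
   Context: $\mathsf{S}_n$ denotes the symmetric group on $\{1,\ldots,n\}$. Orbits of $g$ means orbits of the cyclic group $\langle g\rangle$; fixed points count as orbits of size $1$. *)

theory Defs
  imports
    "HOL-Algebra.Sym_Groups"
    "HOL-Algebra.Group_Action"
    "Jordan_Normal_Form.VS_Connect"
begin

abbreviation GL :: "nat \<Rightarrow> complex mat monoid"
  where "GL d \<equiv> units_of (ring_mat TYPE(complex) d ())"

definition representation :: "('g, 'm) monoid_scheme \<Rightarrow> nat \<Rightarrow> ('g \<Rightarrow> complex mat) \<Rightarrow> bool"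
  where "representation G d \<rho> \<longleftrightarrow> group_hom G (GL d) \<rho>"

definition invariant_subspace ::
    "('g, 'm) monoid_scheme \<Rightarrow> nat \<Rightarrow> ('g \<Rightarrow> complex mat) \<Rightarrow> complex vec set \<Rightarrow> bool"
  where "invariant_subspace G d \<rho> W \<longleftrightarrow>
    VectorSpace.subspace class_ring W (module_vec TYPE(complex) d) \<and>
    (\<forall>g \<in> carrier G. \<forall>w \<in> W. \<rho> g *\<^sub>v w \<in> W)"

definition irreducible_representation ::
    "('g, 'm) monoid_scheme \<Rightarrow> nat \<Rightarrow> ('g \<Rightarrow> complex mat) \<Rightarrow> bool"
  where "irreducible_representation G d \<rho> \<longleftrightarrow>
    representation G d \<rho> \<and> d > 0 \<and>
    (\<forall>W. invariant_subspace G d \<rho> W \<longrightarrow> W = {0\<^sub>v d} \<or> W = carrier_vec d)"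

definition mat_trace :: "'a::comm_monoid_add mat \<Rightarrow> 'a"
  where "mat_trace A = (\<Sum>i<dim_row A. A $$ (i, i))"

text \<open>The values of a character outside \<open>carrier G\<close> are left unspecified.\<close>

definition irreducible_character :: "('g, 'm) monoid_scheme \<Rightarrow> ('g \<Rightarrow> complex) \<Rightarrow> bool"
  where "irreducible_character G \<chi> \<longleftrightarrow>
    (\<exists>d \<rho>. irreducible_representation G d \<rho> \<and> (\<forall>g \<in> carrier G. \<chi> g = mat_trace (\<rho> g)))"

text \<open>The orbits on \<open>{1..n}\<close> of the cyclic subgroup generated by a permutation \<open>g\<close>. An element
  of \<open>sym_group n\<close> is itself a function on the points, so the action is the identity map.\<close>

definition cyclic_orbits :: "nat \<Rightarrow> (nat \<Rightarrow> nat) \<Rightarrow> nat set set"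
  where "cyclic_orbits n g =
    Group_Action.orbits (sym_group n \<lparr> carrier := generate (sym_group n) {g} \<rparr>) {1..n} (\<lambda>p. p)"

end

theory Submission
  imports Defs "Jordan_Normal_Form.DL_Rank" "Jordan_Normal_Form.Spectral_Radius"
begin

text \<open>Take \<open>n = k\<^sup>2\<close>, let \<open>g\<close> be a product of \<open>k\<close> disjoint \<open>k\<close>-cycles, and let \<open>\<chi>\<close> be the character of
  the \<open>k \<times> k\<close> square partition. Frobenius' formula presents \<open>\<chi>\<close> as the alternating sum, over the
  permutations \<open>v\<close> of \<open>{0..<k}\<close>, of the permutation characters on words with content
  \<open>i \<mapsto> k + i - v i\<close>. A word fixed by \<open>g\<close> is constant on the cycles, so its content is divisible by
  \<open>k\<close>; this leaves only \<open>v = id\<close>, with \<open>k!\<close> fixed words.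

  Specht modules are not needed: an integral combination of irreducible characters which has norm
  \<open>1\<close> is an irreducible character up to sign. By Burnside's lemma the norm is a signed count of
  nonnegative integer matrices with prescribed row and column sums, in which everything but one
  matrix cancels. For the square shape the cancellation is elementary, because \<open>\<lambda> + \<delta>\<close> consists of the
  consecutive numbers \<open>k, \<dots>, 2 k - 1\<close>.\<close>

section \<open>Virtual characters\<close>

text \<open>The inner sum of the norm, over \<open>v\<close> with the column sums fixed at a content
  \<beta>, is the coefficient of x^(\<lambda> + \<delta>) in the Vandermonde determinant times
  h_\<beta>, that is, the Kostka number of shape \<lambda> and content \<beta>. It vanishes unless
  \<lambda> dominates \<beta>, and among the compositions of k^2 into k parts the constant one is
  lowest for dominance, so only \<beta> = (k, ..., k) survives. This is what singles out the square.
  Moreover \<open>k + i - v i\<close> lies strictly between 0 and 2k: the determinant has no terms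
  of negative index to discard, and k is the only multiple of k that can occur as a content. The
  norm is taken with the bilinear pairing of f(g) and f(inv g), so that orthogonality follows from
  Schur's lemma without unitary structures; permutation characters agree at g and at its inverse,
  and the pairing becomes a sum of squares. Complete reducibility is avoided because a trace sees
  only composition factors. Norm 1 leaves a sign open, which is harmless for a claim about the
  modulus.\<close>

lemma representation_iff:
  "representation G d \<rho> \<longleftrightarrow> group G \<and> (\<forall>g\<in>carrier G. \<rho> g \<in> carrier_mat d d) \<and>
    (\<forall>g\<in>carrier G. \<forall>h\<in>carrier G. \<rho> (g \<otimes>\<^bsub>G\<^esub> h) = \<rho> g * \<rho> h) \<and> \<rho> \<one>\<^bsub>G\<^esub> = 1\<^sub>m d"
proof -
  interpret R: ring "ring_mat TYPE(complex) d ()" by (rule ring_mat)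
  have GL: "group (GL d)" by (rule R.units_group)
  have carr: "carrier (GL d) = Units (ring_mat TYPE(complex) d ())"
    and mlt: "mult (GL d) = (*)" and one: "one (GL d) = 1\<^sub>m d"
    by (auto simp: units_of_def ring_mat_def)
  show ?thesis
  proof
    assume "representation G d \<rho>"
    then interpret group_hom G "GL d" \<rho> by (simp add: representation_def)
    have "\<rho> g \<in> carrier_mat d d" if "g \<in> carrier G" for g
      using hom_closed[OF that] unfolding carr by (simp add: Units_def ring_mat_simps)
    moreover have "\<rho> (g \<otimes>\<^bsub>G\<^esub> h) = \<rho> g * \<rho> h" if "g \<in> carrier G" "h \<in> carrier G" for g h
      using hom_mult[OF that] by (simp add: mlt)
    moreover have "\<rho> \<one>\<^bsub>G\<^esub> = 1\<^sub>m d" using hom_one by (simp add: one)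
    ultimately show "group G \<and> (\<forall>g\<in>carrier G. \<rho> g \<in> carrier_mat d d) \<and>
      (\<forall>g\<in>carrier G. \<forall>h\<in>carrier G. \<rho> (g \<otimes>\<^bsub>G\<^esub> h) = \<rho> g * \<rho> h) \<and> \<rho> \<one>\<^bsub>G\<^esub> = 1\<^sub>m d"
      by auto
  next
    assume *: "group G \<and> (\<forall>g\<in>carrier G. \<rho> g \<in> carrier_mat d d) \<and>
      (\<forall>g\<in>carrier G. \<forall>h\<in>carrier G. \<rho> (g \<otimes>\<^bsub>G\<^esub> h) = \<rho> g * \<rho> h) \<and> \<rho> \<one>\<^bsub>G\<^esub> = 1\<^sub>m d"
    then interpret G: group G by simp
    have "\<rho> g \<in> carrier (GL d)" if g: "g \<in> carrier G" for g
    proof -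
      have "\<rho> g * \<rho> (inv\<^bsub>G\<^esub> g) = 1\<^sub>m d" "\<rho> (inv\<^bsub>G\<^esub> g) * \<rho> g = 1\<^sub>m d"
        using * g by (metis G.inv_closed G.r_inv, metis G.inv_closed G.l_inv)
      then show ?thesis using * g unfolding carr by (auto simp: Units_def ring_mat_simps intro!: bexI[of _ "\<rho> (inv\<^bsub>G\<^esub> g)"])
    qed
    then have "\<rho> \<in> hom G (GL d)" using * by (auto simp: hom_def mlt)
    then show "representation G d \<rho>"
      unfolding representation_def group_hom_def group_hom_axioms_def using GL * by simp
  qed
qed

text \<open>Independent sets have at most \<open>n\<close> elements, so maximal ones exist. A
  maximal independent subset of \<open>W\<close> spans \<open>W\<close>; a maximal independent
  superset of it is a basis of the whole space. Lists are returned because they become the columns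
  of a matrix.\<close>

lemma (in vec_space) subspace_basis_extension:
  assumes W: "VectorSpace.subspace class_ring W V"
  obtains as bs where "set as \<subseteq> W" "span (set as) = W" "distinct (as @ bs)"
    "lin_indpt (set (as @ bs))" "set (as @ bs) \<subseteq> carrier_vec n" "length (as @ bs) = n"
proof -
  have sub: "W \<subseteq> carrier_vec n" "submodule class_ring W V"
    using W by (auto simp: VectorSpace.subspace_def submodule_def module_vec_def)
  have bnd: "finite A \<and> card A \<le> n" if "A \<subseteq> carrier_vec n" "lin_indpt A" for A
    using li_le_dim[OF fin_dim that(1) that(2)] dim_is_n by simp
  have "\<exists>A. finite A \<and> maximal A (\<lambda>S. S \<subseteq> W \<and> lin_indpt S)"
  proof (rule maximal_exists)
    show "finite S \<and> card S \<le> n" if "S \<subseteq> W \<and> lin_indpt S" for S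
      using bnd that sub(1) by blast
    show "{} \<subseteq> W \<and> lin_indpt {}" by (auto simp: lin_dep_def)
  qed
  then obtain A where A: "finite A" "maximal A (\<lambda>S. S \<subseteq> W \<and> lin_indpt S)" by blast
  have AW: "A \<subseteq> W" and Ali: "lin_indpt A" using A(2) by (auto simp: maximal_def)
  have spanA: "span A = W"
  proof
    show "span A \<subseteq> W" using span_is_subset AW sub(2) by (simp add: span_is_subset)
    show "W \<subseteq> span A"
    proof
      fix w assume w: "w \<in> W"
      show "w \<in> span A"
      proof (rule ccontr)
        assume ns: "w \<notin> span A"
        have "A \<subseteq> carrier_vec n" using AW sub by auto
        then have nA: "w \<notin> A" using ns span_mem by blast
        have "lin_indpt (A \<union> {w})"
          using lin_dep_iff_in_span[of A w] ns nA Ali \<open>A \<subseteq> carrier_vec n\<close> w sub(1) by auto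
        then show False using A(2) nA w AW unfolding maximal_def by blast
      qed
    qed
  qed
  define P where "P = (\<lambda>S. S \<subseteq> carrier_vec n \<and> lin_indpt S \<and> A \<subseteq> S)"
  have "\<exists>B. finite B \<and> maximal B P"
    by (rule maximal_exists[of P n A]) (use bnd AW sub(1) Ali in \<open>auto simp: P_def\<close>)
  then obtain B where B: "finite B" "maximal B P" by blast
  have AB: "A \<subseteq> B" using B by (auto simp: maximal_def P_def)
  have "maximal B (\<lambda>S. S \<subseteq> carrier_vec n \<and> lin_indpt S)"
    using B(2) AB unfolding maximal_def P_def by blast
  then have "basis B" by (rule max_li_is_basis)
  then have cB: "card B = n" using dim_basis[OF B(1)] dim_is_n by simp
  obtain as where as: "set as = A" "distinct as" using finite_distinct_list[OF A(1)] by blast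
  obtain bs where bs: "set bs = B - A" "distinct bs" using finite_distinct_list[of "B - A"] B(1) by blast
  have *: "set (as @ bs) = B" "distinct (as @ bs)" using as bs AB by auto
  moreover have "length (as @ bs) = n" using * cB by (metis distinct_card)
  ultimately show thesis using that[of as bs] as AW spanA B(2)
    by (auto simp: maximal_def P_def)
qed

text \<open>Let \<open>P = [P1 P2]\<close> have a basis adapted to \<open>W\<close> as its columns
  and let \<open>Q\<close> be its inverse, cut into row blocks \<open>Q1\<close>, \<open>Q2\<close>.
  The identities are blocks of \<open>Q * P = 1\<close> and of \<open>P * Q = 1\<close>. They allow
  change of basis without handling block matrices.\<close>

lemma subspace_complement_projections:
  fixes W :: "complex vec set"
  assumes W: "VectorSpace.subspace class_ring W (module_vec TYPE(complex) d)"
  obtains r P1 Q1 P2 Q2 where "r \<le> d"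
    "P1 \<in> carrier_mat d r" "Q1 \<in> carrier_mat r d"
    "P2 \<in> carrier_mat d (d - r)" "Q2 \<in> carrier_mat (d - r) d"
    "Q1 * P1 = 1\<^sub>m r" "Q2 * P2 = 1\<^sub>m (d - r)" "Q2 * P1 = 0\<^sub>m (d - r) r"
    "P1 * Q1 + P2 * Q2 = 1\<^sub>m d" "W = {P1 *\<^sub>v x | x. x \<in> carrier_vec r}"
proof -
  interpret vec_space "TYPE(complex)" d .
  obtain as bs where ab: "set as \<subseteq> W" "span (set as) = W" "distinct (as @ bs)"
    "lin_indpt (set (as @ bs))" "set (as @ bs) \<subseteq> carrier_vec d" "length (as @ bs) = d"
    using subspace_basis_extension[OF W] by blast
  define r where "r = length as"
  define P where "P = mat_of_cols d (as @ bs)"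
  have P: "P \<in> carrier_mat d d" using ab(6) by (auto simp: P_def)
  have colsP: "cols P = as @ bs" using ab(5) by (simp add: P_def)
  have "rank P = d" using lin_indpt_full_rank[OF P] colsP ab by simp
  then have "det P \<noteq> 0" using det_rank_iff[OF P] by simp
  then obtain Q where Q: "Q \<in> carrier_mat d d" "P * Q = 1\<^sub>m d" "Q * P = 1\<^sub>m d"
    using det_non_zero_imp_unit[OF P] by (auto simp: Units_def ring_mat_def)
  have rd: "r \<le> d" using ab(6) by (simp add: r_def)
  define P1 where "P1 = mat d r (\<lambda>(i,j). P $$ (i,j))"
  define P2 where "P2 = mat d (d - r) (\<lambda>(i,j). P $$ (i,r + j))"
  define Q1 where "Q1 = mat r d (\<lambda>(i,j). Q $$ (i,j))"
  define Q2 where "Q2 = mat (d - r) d (\<lambda>(i,j). Q $$ (r + i,j))"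
  have QP: "(\<Sum>l<d. Q $$ (i,l) * P $$ (l,j)) = (if i = j then 1 else 0)" if "i < d" "j < d" for i j
    using arg_cong[OF Q(3), of "\<lambda>M. M $$ (i,j)"] that P Q(1)
    by (simp add: scalar_prod_def atLeast0LessThan)
  have PQ: "(\<Sum>l<d. P $$ (i,l) * Q $$ (l,j)) = (if i = j then 1 else 0)" if "i < d" "j < d" for i j
    using arg_cong[OF Q(2), of "\<lambda>M. M $$ (i,j)"] that P Q(1)
    by (simp add: scalar_prod_def atLeast0LessThan)
  have 1: "Q1 * P1 = 1\<^sub>m r"
    by (rule eq_matI) (use rd QP in \<open>auto simp: Q1_def P1_def scalar_prod_def atLeast0LessThan\<close>)
  have 2: "Q2 * P2 = 1\<^sub>m (d - r)"
    by (rule eq_matI) (use rd QP in \<open>auto simp: Q2_def P2_def scalar_prod_def atLeast0LessThan\<close>)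
  have 3: "Q2 * P1 = 0\<^sub>m (d - r) r"
    by (rule eq_matI) (use rd QP in \<open>auto simp: Q2_def P1_def scalar_prod_def atLeast0LessThan\<close>)
  have split: "(\<Sum>l<d. f l) = (\<Sum>l<r. f l) + (\<Sum>l<d - r. f (r + l))" for f :: "nat \<Rightarrow> complex"
  proof -
    have "(\<Sum>l<r + e. f l) = (\<Sum>l<r. f l) + (\<Sum>l<e. f (r + l))" for e
      by (induction e) (auto simp: add.assoc)
    from this[of "d - r"] show ?thesis using rd by simp
  qed
  have 4: "P1 * Q1 + P2 * Q2 = 1\<^sub>m d"
    by (rule eq_matI) (use rd PQ[unfolded split] in
      \<open>auto simp: Q1_def Q2_def P1_def P2_def scalar_prod_def atLeast0LessThan\<close>)
  have P1c: "P1 \<in> carrier_mat d r" by (simp add: P1_def)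
  have colsP1: "cols P1 = as"
  proof (rule nth_equalityI)
    show "length (cols P1) = length as" by (simp add: P1_def r_def)
    fix i assume "i < length (cols P1)"
    then have i: "i < r" by (simp add: P1_def)
    have "col P1 i = col P i" using i rd P by (intro eq_vecI) (auto simp: P1_def)
    also have "\<dots> = as ! i" using colsP i rd P
      by (metis carrier_matD(2) cols_nth nth_append order_less_le_trans r_def)
    finally show "cols P1 ! i = as ! i" using i by (simp add: P1_def)
  qed
  have "W = {P1 *\<^sub>v x | x. x \<in> carrier_vec r}"
  proof (intro equalityI subsetI)
    fix w assume "w \<in> W"
    then have "w \<in> span (set as)" using ab by simp
    then obtain a where "w = lincomb a (set as)"
      using finite_in_span[of "set as" w] ab(5) by auto
    then have "w = P1 *\<^sub>v vec r (\<lambda>i. a (col P1 i))"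
      using mat_mult_eq_lincomb[OF P1c] colsP1 ab(3) by simp
    then show "w \<in> {P1 *\<^sub>v x | x. x \<in> carrier_vec r}" by auto
  next
    fix w assume "w \<in> {P1 *\<^sub>v x | x. x \<in> carrier_vec r}"
    then obtain x where x: "x \<in> carrier_vec r" "w = P1 *\<^sub>v x" by auto
    have "w = lincomb (\<lambda>a. x $ find_first a (cols P1)) (set as)"
      using lincomb_eq_mat_mult[OF P1c x(1)] x(2) colsP1 ab(3) by simp
    then have "w \<in> span (set as)" unfolding span_def by auto
    then show "w \<in> W" using ab(2) by simp
  qed
  then show thesis using that[OF rd P1c _ _ _ 1 2 3 4] by (simp add: Q1_def P2_def Q2_def)
qed

section \<open>Traces, and integral combinations of irreducible characters\<close>

lemma mat_trace_mult_commute: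
  fixes A B :: "'a::comm_semiring_0 mat"
  assumes "A \<in> carrier_mat n m" "B \<in> carrier_mat m n"
  shows "mat_trace (A * B) = mat_trace (B * A)"
proof -
  have "mat_trace (A * B) = (\<Sum>i<n. \<Sum>j<m. A $$ (i,j) * B $$ (j,i))"
    using assms by (auto simp: mat_trace_def scalar_prod_def atLeast0LessThan intro!: sum.cong)
  also have "\<dots> = (\<Sum>j<m. \<Sum>i<n. B $$ (j,i) * A $$ (i,j))"
    by (subst sum.swap) (simp add: mult.commute)
  also have "\<dots> = mat_trace (B * A)"
    using assms by (auto simp: mat_trace_def scalar_prod_def atLeast0LessThan intro!: sum.cong)
  finally show ?thesis .
qed

lemma mult_unit_vec_col:
  assumes "A \<in> carrier_mat n m" "j < m"
  shows "A *\<^sub>v unit_vec m j = (col A j :: 'a::semiring_1 vec)"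
  using assms by (intro eq_vecI) (auto simp: scalar_prod_right_unit)

lemma mat_trace_add:
  assumes "A \<in> carrier_mat n n" "B \<in> carrier_mat n n"
  shows "mat_trace (A + B) = mat_trace A + mat_trace B"
  using assms by (auto simp: mat_trace_def sum.distrib)

text \<open>Characters are unspecified off the carrier, so one class function has many
  representatives. Requiring the members of \<open>F\<close> to vanish there makes distinct members
  differ on the group itself, as orthogonality demands.\<close>

definition virtual_character :: "('g, 'm) monoid_scheme \<Rightarrow> ('g \<Rightarrow> complex) \<Rightarrow> bool"
  where "virtual_character G f \<longleftrightarrow> (\<exists>F (m :: ('g \<Rightarrow> complex) \<Rightarrow> int). finite F \<and>
    (\<forall>\<chi>\<in>F. irreducible_character G \<chi> \<and> (\<forall>g. g \<notin> carrier G \<longrightarrow> \<chi> g = 0)) \<and>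
    (\<forall>g\<in>carrier G. f g = (\<Sum>\<chi>\<in>F. of_int (m \<chi>) * \<chi> g)))"

lemma virtual_character_cong:
  assumes "virtual_character G f" "\<And>g. g \<in> carrier G \<Longrightarrow> f g = f' g"
  shows "virtual_character G f'"
  using assms unfolding virtual_character_def by simp

lemma virtual_character_0: "virtual_character G (\<lambda>g. 0)"
  unfolding virtual_character_def by (rule exI[of _ "{}"]) auto

lemma virtual_character_add:
  assumes "virtual_character G f" "virtual_character G f'"
  shows "virtual_character G (\<lambda>g. f g + f' g)"
proof -
  obtain F m where F: "finite F"
    "\<forall>\<chi>\<in>F. irreducible_character G \<chi> \<and> (\<forall>g. g \<notin> carrier G \<longrightarrow> \<chi> g = 0)"
    "\<forall>g\<in>carrier G. f g = (\<Sum>\<chi>\<in>F. of_int (m \<chi>) * \<chi> g)"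
    using assms(1) unfolding virtual_character_def by blast
  obtain F' m' where F': "finite F'"
    "\<forall>\<chi>\<in>F'. irreducible_character G \<chi> \<and> (\<forall>g. g \<notin> carrier G \<longrightarrow> \<chi> g = 0)"
    "\<forall>g\<in>carrier G. f' g = (\<Sum>\<chi>\<in>F'. of_int (m' \<chi>) * \<chi> g)"
    using assms(2) unfolding virtual_character_def by blast
  define M where "M \<chi> = (if \<chi> \<in> F then m \<chi> else 0) + (if \<chi> \<in> F' then m' \<chi> else 0)" for \<chi>
  have "f g + f' g = (\<Sum>\<chi>\<in>F \<union> F'. of_int (M \<chi>) * \<chi> g)" if "g \<in> carrier G" for g
  proof -
    have "f g = (\<Sum>\<chi>\<in>F \<union> F'. of_int (if \<chi> \<in> F then m \<chi> else 0) * \<chi> g)"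
      using F F' that by (auto intro!: sum.mono_neutral_cong_left)
    moreover have "f' g = (\<Sum>\<chi>\<in>F \<union> F'. of_int (if \<chi> \<in> F' then m' \<chi> else 0) * \<chi> g)"
      using F F' that by (auto intro!: sum.mono_neutral_cong_left)
    ultimately show ?thesis
      by (simp only: M_def of_int_add distrib_right sum.distrib)
  qed
  then show ?thesis unfolding virtual_character_def
    using F F' by (intro exI[of _ "F \<union> F'"] exI[of _ M]) auto
qed

lemma virtual_character_scale:
  assumes "virtual_character G f"
  shows "virtual_character G (\<lambda>g. of_int c * f g)"
proof -
  obtain F m where F: "finite F"
    "\<forall>\<chi>\<in>F. irreducible_character G \<chi> \<and> (\<forall>g. g \<notin> carrier G \<longrightarrow> \<chi> g = 0)"
    "\<forall>g\<in>carrier G. f g = (\<Sum>\<chi>\<in>F. of_int (m \<chi>) * \<chi> g)"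
    using assms(1) unfolding virtual_character_def by blast
  then show ?thesis unfolding virtual_character_def
    by (intro exI[of _ F] exI[of _ "\<lambda>\<chi>. c * m \<chi>"]) (auto simp: sum_distrib_left mult.assoc)
qed

lemma virtual_character_sum:
  assumes "\<And>a. a \<in> A \<Longrightarrow> virtual_character G (f a)"
  shows "virtual_character G (\<lambda>g. \<Sum>a\<in>A. f a g)"
  using assms
  by (induction A rule: infinite_finite_induct) (auto simp: virtual_character_0 virtual_character_add)

lemma virtual_character_irreducible:
  assumes "irreducible_character G \<chi>"
  shows "virtual_character G \<chi>"
proof -
  let ?\<chi> = "\<lambda>g. if g \<in> carrier G then \<chi> g else 0"
  have "irreducible_character G ?\<chi>"
    using assms unfolding irreducible_character_def by auto
  then show ?thesis unfolding virtual_character_def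
    by (intro exI[of _ "{?\<chi>}"] exI[of _ "\<lambda>_. 1"]) auto
qed

text \<open>In a basis adapted to \<open>W\<close> every \<open>\<rho> g\<close> is block
  triangular; \<open>\<sigma>\<close> is the action on \<open>W\<close>, \<open>\<tau>\<close> the
  action on the quotient. Only the trace has to split, so no invariant complement of
  \<open>W\<close> is sought.\<close>

lemma representation_block_triangular:
  assumes rep: "representation G d \<rho>" and W: "invariant_subspace G d \<rho> W"
    and W0: "W \<noteq> {0\<^sub>v d}" and W1: "W \<noteq> carrier_vec d"
  obtains r \<sigma> \<tau> where "r < d" "0 < r" "representation G r \<sigma>" "representation G (d - r) \<tau>"
    "\<And>g. g \<in> carrier G \<Longrightarrow> mat_trace (\<rho> g) = mat_trace (\<sigma> g) + mat_trace (\<tau> g)"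
proof -
  have grp: "group G" and \<rho>c: "\<And>g. g \<in> carrier G \<Longrightarrow> \<rho> g \<in> carrier_mat d d"
    and \<rho>m: "\<And>g h. g \<in> carrier G \<Longrightarrow> h \<in> carrier G \<Longrightarrow> \<rho> (g \<otimes>\<^bsub>G\<^esub> h) = \<rho> g * \<rho> h"
    and \<rho>1: "\<rho> \<one>\<^bsub>G\<^esub> = 1\<^sub>m d"
    using rep by (auto simp: representation_iff)
  interpret G: group G by fact
  obtain r P1 Q1 P2 Q2 where r: "r \<le> d" and P1: "P1 \<in> carrier_mat d r" and Q1: "Q1 \<in> carrier_mat r d"
    and P2: "P2 \<in> carrier_mat d (d - r)" and Q2: "Q2 \<in> carrier_mat (d - r) d"
    and QP: "Q1 * P1 = 1\<^sub>m r" "Q2 * P2 = 1\<^sub>m (d - r)" "Q2 * P1 = 0\<^sub>m (d - r) r"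
    and PQ: "P1 * Q1 + P2 * Q2 = 1\<^sub>m d" and WP: "W = {P1 *\<^sub>v x | x. x \<in> carrier_vec r}"
    using subspace_complement_projections[of W d] W unfolding invariant_subspace_def by blast
  have inv: "\<rho> g *\<^sub>v w \<in> W" if "g \<in> carrier G" "w \<in> W" for g w
    using W that by (auto simp: invariant_subspace_def)
  have "r \<noteq> 0"
  proof
    assume r0: "r = 0"
    have *: "P1 *\<^sub>v x = 0\<^sub>v d" if "x \<in> carrier_vec r" for x
    proof (rule eq_vecI)
      fix i assume "i < dim_vec (0\<^sub>v d :: complex vec)"
      then show "(P1 *\<^sub>v x) $ i = 0\<^sub>v d $ i"
        using P1 that r0 by (simp add: scalar_prod_def)
    qed (use P1 in simp)
    have "W = {0\<^sub>v d}"
    proof (rule equalityI; rule subsetI)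
      fix w assume "w \<in> W"
      then obtain x where "w = P1 *\<^sub>v x" "x \<in> carrier_vec r" unfolding WP mem_Collect_eq by (elim exE conjE)
      then show "w \<in> {0\<^sub>v d}" by (simp add: *)
    next
      fix w :: "complex vec" assume "w \<in> {0\<^sub>v d}"
      then have "w = P1 *\<^sub>v 0\<^sub>v r" using *[OF zero_carrier_vec] by simp
      then show "w \<in> W" unfolding WP mem_Collect_eq by (intro exI[of _ "0\<^sub>v r"] conjI zero_carrier_vec)
    qed
    then show False using W0 by simp
  qed
  have "r \<noteq> d"
  proof
    assume rd: "r = d"
    have "P1 * Q1 = 1\<^sub>m d" using mat_mult_left_right_inverse[of Q1 d P1] P1 Q1 QP rd by simp
    then have "P1 *\<^sub>v (Q1 *\<^sub>v w) = w" if "w \<in> carrier_vec d" for w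
      using assoc_mult_mat_vec[OF P1 Q1, of w] that by simp
    moreover have "Q1 *\<^sub>v w \<in> carrier_vec r" if "w \<in> carrier_vec d" for w
      using Q1 that by simp
    ultimately have "w \<in> W" if "w \<in> carrier_vec d" for w
      unfolding WP mem_Collect_eq using that by (intro exI[of _ "Q1 *\<^sub>v w"]) simp
    moreover have "W \<subseteq> carrier_vec d"
      using W by (auto simp: invariant_subspace_def VectorSpace.subspace_def submodule_def module_vec_def)
    ultimately show False using W1 by (metis subsetI subset_antisym)
  qed
  define \<sigma> where "\<sigma> g = Q1 * (\<rho> g * P1)" for g
  define \<tau> where "\<tau> g = Q2 * (\<rho> g * P2)" for g
  have \<sigma>c: "\<sigma> g \<in> carrier_mat r r" if "g \<in> carrier G" for g
    using that Q1 P1 \<rho>c unfolding \<sigma>_def by (meson mult_carrier_mat)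
  have \<tau>c: "\<tau> g \<in> carrier_mat (d - r) (d - r)" if "g \<in> carrier G" for g
    using that Q2 P2 \<rho>c unfolding \<tau>_def by (meson mult_carrier_mat)
  \<comment> \<open>Invariance of \<open>W\<close> in matrix form: each column of
    \<open>\<rho> g * P1\<close> lies in \<open>W\<close>, the image of \<open>P1\<close>, so the
    product is \<open>P1 * X\<close> for some \<open>X\<close>, and multiplying by \<open>Q1\<close>
    on the left identifies \<open>X\<close> with \<open>\<sigma> g\<close>.\<close>
  have \<sigma>P: "\<rho> g * P1 = P1 * \<sigma> g" if g: "g \<in> carrier G" for g
  proof -
    have c: "\<rho> g * P1 \<in> carrier_mat d r" using \<rho>c[OF g] P1 by simp
    have "\<exists>x. x \<in> carrier_vec r \<and> col (\<rho> g * P1) j = P1 *\<^sub>v x" if "j < r" for j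
    proof -
      have "col (\<rho> g * P1) j = \<rho> g *\<^sub>v (P1 *\<^sub>v unit_vec r j)"
        using col_mult2[OF \<rho>c[OF g] P1 that] mult_unit_vec_col[OF P1 that] by simp
      also have "\<dots> \<in> W" by (rule inv[OF g]) (auto simp: WP)
      finally show ?thesis by (auto simp: WP)
    qed
    then obtain x where x: "\<And>j. j < r \<Longrightarrow> x j \<in> carrier_vec r \<and> col (\<rho> g * P1) j = P1 *\<^sub>v x j"
      by metis
    define X where "X = mat r r (\<lambda>(i,j). x j $ i)"
    have X: "X \<in> carrier_mat r r" by (simp add: X_def)
    have "col X j = x j" if "j < r" for j using conjunct1[OF x[OF that]] that by (intro eq_vecI) (auto simp: X_def)
    moreover have "col (P1 * X) j = P1 *\<^sub>v col X j" if "j < r" for j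
      by (rule col_mult2[OF P1 X that])
    ultimately have "col (\<rho> g * P1) j = col (P1 * X) j" if "j < r" for j
      using x that by metis
    moreover have "P1 * X \<in> carrier_mat d r" using P1 X by simp
    ultimately have eq: "\<rho> g * P1 = P1 * X"
      using c by (metis carrier_matD mat_col_eqI)
    have "\<sigma> g = Q1 * (P1 * X)" by (simp add: \<sigma>_def eq)
    also have "\<dots> = X" using assoc_mult_mat[OF Q1 P1 X] QP X by simp
    finally show ?thesis using eq by simp
  qed
  \<comment> \<open>\<open>Q2\<close> is the projection to the quotient. Inserting
    \<open>P1 * Q1 + P2 * Q2 = 1\<close> on the right, the first summand dies since
    \<open>Q2 * \<rho> g * P1 = Q2 * P1 * \<sigma> g = 0\<close>.\<close>
  have \<tau>Q: "Q2 * \<rho> g = \<tau> g * Q2" if g: "g \<in> carrier G" for g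
  proof -
    note R = \<rho>c[OF g]
    have Q2R: "Q2 * \<rho> g \<in> carrier_mat (d - r) d" using Q2 R by simp
    have "Q2 * \<rho> g = Q2 * \<rho> g * (P1 * Q1 + P2 * Q2)" unfolding PQ by (rule right_mult_one_mat[OF Q2R, symmetric])
    also have "\<dots> = Q2 * \<rho> g * (P1 * Q1) + Q2 * \<rho> g * (P2 * Q2)"
      by (rule mult_add_distrib_mat[OF Q2R]) (use P1 Q1 P2 Q2 in auto)
    also have "Q2 * \<rho> g * (P1 * Q1) = Q2 * (\<rho> g * P1) * Q1"
      using assoc_mult_mat[OF Q2R P1 Q1] assoc_mult_mat[OF Q2 R P1] by simp
    also have "\<dots> = 0\<^sub>m (d - r) d"
    proof -
      have "Q2 * (\<rho> g * P1) = Q2 * P1 * \<sigma> g"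
        unfolding \<sigma>P[OF g] by (rule assoc_mult_mat[OF Q2 P1 \<sigma>c[OF g], symmetric])
      also have "\<dots> = 0\<^sub>m (d - r) r" unfolding QP(3) by (rule left_mult_zero_mat[OF \<sigma>c[OF g]])
      finally show ?thesis using left_mult_zero_mat[OF Q1] by simp
    qed
    also have "Q2 * \<rho> g * (P2 * Q2) = \<tau> g * Q2"
      unfolding \<tau>_def using assoc_mult_mat[OF Q2R P2 Q2] assoc_mult_mat[OF Q2 R P2] by simp
    finally show ?thesis using \<tau>c[OF g] Q2 by simp
  qed
  have rep\<sigma>: "representation G r \<sigma>"
    unfolding representation_iff
  proof (intro conjI ballI)
    fix g h assume g: "g \<in> carrier G" and h: "h \<in> carrier G"
    have "\<sigma> (g \<otimes>\<^bsub>G\<^esub> h) = Q1 * (\<rho> g * (\<rho> h * P1))"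
      using g h \<rho>m[OF g h] assoc_mult_mat[OF \<rho>c[OF g] \<rho>c[OF h] P1] by (simp add: \<sigma>_def)
    also have "\<dots> = Q1 * ((\<rho> g * P1) * \<sigma> h)"
      unfolding \<sigma>P[OF h] using assoc_mult_mat[OF \<rho>c[OF g] P1 \<sigma>c[OF h]] by simp
    also have "\<dots> = \<sigma> g * \<sigma> h"
      unfolding \<sigma>_def[of g] using assoc_mult_mat[OF Q1 _ \<sigma>c[OF h], of "\<rho> g * P1"] \<rho>c[OF g] P1 by simp
    finally show "\<sigma> (g \<otimes>\<^bsub>G\<^esub> h) = \<sigma> g * \<sigma> h" .
  qed (use grp \<sigma>c \<rho>1 P1 QP in \<open>auto simp: \<sigma>_def\<close>)
  have rep\<tau>: "representation G (d - r) \<tau>"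
    unfolding representation_iff
  proof (intro conjI ballI)
    fix g h assume g: "g \<in> carrier G" and h: "h \<in> carrier G"
    have "\<tau> (g \<otimes>\<^bsub>G\<^esub> h) = (Q2 * \<rho> g) * (\<rho> h * P2)"
      using g h \<rho>m[OF g h] assoc_mult_mat[OF \<rho>c[OF g] \<rho>c[OF h] P2]
        assoc_mult_mat[OF Q2 \<rho>c[OF g], of "\<rho> h * P2" "d - r"] \<rho>c[OF h] P2 by (simp add: \<tau>_def)
    also have "\<dots> = \<tau> g * \<tau> h"
      unfolding \<tau>Q[OF g] \<tau>_def[of h]
      using assoc_mult_mat[OF \<tau>c[OF g] Q2, of "\<rho> h * P2" "d - r"] \<rho>c[OF h] P2 by simp
    finally show "\<tau> (g \<otimes>\<^bsub>G\<^esub> h) = \<tau> g * \<tau> h" .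
  qed (use grp \<tau>c \<rho>1 P2 QP in \<open>auto simp: \<tau>_def\<close>)
  have "mat_trace (\<rho> g) = mat_trace (\<sigma> g) + mat_trace (\<tau> g)" if g: "g \<in> carrier G" for g
  proof -
    note R = \<rho>c[OF g]
    have "\<rho> g = \<rho> g * (P1 * Q1 + P2 * Q2)" unfolding PQ by (rule right_mult_one_mat[OF R, symmetric])
    also have "\<dots> = \<rho> g * (P1 * Q1) + \<rho> g * (P2 * Q2)"
      by (rule mult_add_distrib_mat[OF R]) (use P1 Q1 P2 Q2 in auto)
    also have "\<rho> g * (P1 * Q1) = (\<rho> g * P1) * Q1" using assoc_mult_mat[OF R P1 Q1] by simp
    also have "\<rho> g * (P2 * Q2) = (\<rho> g * P2) * Q2" using assoc_mult_mat[OF R P2 Q2] by simp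
    finally have "\<rho> g = \<rho> g * P1 * Q1 + \<rho> g * P2 * Q2" .
    then have "mat_trace (\<rho> g) = mat_trace (\<rho> g * P1 * Q1 + \<rho> g * P2 * Q2)" by simp
    also have "\<dots> = mat_trace (\<rho> g * P1 * Q1) + mat_trace (\<rho> g * P2 * Q2)"
      by (rule mat_trace_add) (use R P1 Q1 P2 Q2 in auto)
    also have "mat_trace (\<rho> g * P1 * Q1) = mat_trace (\<sigma> g)"
      unfolding \<sigma>_def by (rule mat_trace_mult_commute[of _ d r]) (use R P1 Q1 in auto)
    also have "mat_trace (\<rho> g * P2 * Q2) = mat_trace (\<tau> g)"
      unfolding \<tau>_def by (rule mat_trace_mult_commute[of _ d "d - r"]) (use R P2 Q2 in auto)
    finally show ?thesis .
  qed
  then show thesis using that[of r \<sigma> \<tau>] rep\<sigma> rep\<tau> r \<open>r \<noteq> 0\<close> \<open>r \<noteq> d\<close> by simp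
qed

text \<open>Strong induction on the dimension collects the traces of the composition factors.
  Dimension 0 is a separate case because irreducibility requires \<open>d > 0\<close>; the trace is
  then an empty sum.\<close>

lemma virtual_character_representation:
  assumes "representation G d \<rho>"
  shows "virtual_character G (\<lambda>g. mat_trace (\<rho> g))"
  using assms
proof (induction d arbitrary: \<rho> rule: less_induct)
  case (less d)
  show ?case
  proof (cases "d = 0")
    case True
    then have "mat_trace (\<rho> g) = 0" if "g \<in> carrier G" for g
      using less.prems that by (auto simp: representation_iff mat_trace_def)
    then show ?thesis by (intro virtual_character_cong[OF virtual_character_0]) simp
  next
    case False
    show ?thesis
    proof (cases "irreducible_representation G d \<rho>")
      case True
      then show ?thesis
        by (intro virtual_character_irreducible) (auto simp: irreducible_character_def)
    next
      case red: False
      then obtain W where W: "invariant_subspace G d \<rho> W" "W \<noteq> {0\<^sub>v d}" "W \<noteq> carrier_vec d"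
        using False less.prems by (auto simp: irreducible_representation_def)
      obtain r \<sigma> \<tau> where *: "r < d" "0 < r" "representation G r \<sigma>" "representation G (d - r) \<tau>"
        "\<And>g. g \<in> carrier G \<Longrightarrow> mat_trace (\<rho> g) = mat_trace (\<sigma> g) + mat_trace (\<tau> g)"
        using representation_block_triangular[OF less.prems W] by metis
      have "virtual_character G (\<lambda>g. mat_trace (\<sigma> g) + mat_trace (\<tau> g))"
        using * by (intro virtual_character_add less.IH) auto
      then show ?thesis by (rule virtual_character_cong) (simp only: *(5))
    qed
  qed
qed

section \<open>Schur orthogonality\<close>

lemma invariant_subspaceI:
  assumes "W \<subseteq> carrier_vec d" "0\<^sub>v d \<in> W" "\<And>v w. v \<in> W \<Longrightarrow> w \<in> W \<Longrightarrow> v + w \<in> W"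
    "\<And>c v. v \<in> W \<Longrightarrow> c \<cdot>\<^sub>v v \<in> W" "\<And>g w. g \<in> carrier G \<Longrightarrow> w \<in> W \<Longrightarrow> \<rho> g *\<^sub>v w \<in> W"
  shows "invariant_subspace G d \<rho> W"
  unfolding invariant_subspace_def VectorSpace.subspace_def submodule_def
  using assms vec_module[of d] vec_vs[of d] by (auto simp: module_vec_simps)

text \<open>Schur's lemma: the kernel \<open>K\<close> and the image \<open>I\<close> of
  \<open>Y\<close> are invariant, so a nonzero \<open>Y\<close> is bijective. The dimensions are not
  assumed equal, hence the explicit two-sided inverse.\<close>

lemma irreducible_intertwiner:
  assumes \<rho>: "irreducible_representation G d \<rho>" and \<sigma>: "irreducible_representation G e \<sigma>"
    and Y: "Y \<in> carrier_mat d e" and int: "\<And>g. g \<in> carrier G \<Longrightarrow> \<rho> g * Y = Y * \<sigma> g"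
    and nz: "Y \<noteq> 0\<^sub>m d e"
  obtains X where "X \<in> carrier_mat e d" "Y * X = 1\<^sub>m d" "X * Y = 1\<^sub>m e"
proof -
  have \<rho>c: "\<rho> g \<in> carrier_mat d d" and \<sigma>c: "\<sigma> g \<in> carrier_mat e e" if "g \<in> carrier G" for g
    using \<rho> \<sigma> that by (auto simp: irreducible_representation_def representation_iff)
  have intv: "\<rho> g *\<^sub>v (Y *\<^sub>v x) = Y *\<^sub>v (\<sigma> g *\<^sub>v x)" if "g \<in> carrier G" "x \<in> carrier_vec e" for g x
    using assoc_mult_mat_vec[OF \<rho>c[OF that(1)] Y that(2)] assoc_mult_mat_vec[OF Y \<sigma>c[OF that(1)] that(2)]
      int[OF that(1)] by simp
  define K where "K = {x \<in> carrier_vec e. Y *\<^sub>v x = 0\<^sub>v d}"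
  define I where "I = (\<lambda>x. Y *\<^sub>v x) ` carrier_vec e"
  \<comment> \<open>A single nonzero column shows both that \<open>K\<close> is not the whole space
    and that \<open>I\<close> is not zero.\<close>
  have "\<exists>j<e. col Y j \<noteq> 0\<^sub>v d"
  proof (rule ccontr)
    assume "\<not> (\<exists>j<e. col Y j \<noteq> 0\<^sub>v d)"
    then have "Y = 0\<^sub>m d e" using Y by (intro mat_col_eqI) auto
    then show False using nz by simp
  qed
  then obtain j where j: "j < e" "col Y j \<noteq> 0\<^sub>v d" by blast
  have Yj: "Y *\<^sub>v unit_vec e j \<noteq> 0\<^sub>v d" using mult_unit_vec_col[OF Y j(1)] j(2) by simp
  have "invariant_subspace G e \<sigma> K"
  proof (rule invariant_subspaceI)
    show "v + w \<in> K" if "v \<in> K" "w \<in> K" for v w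
      using that mult_add_distrib_mat_vec[OF Y, of v w] by (auto simp: K_def)
    show "c \<cdot>\<^sub>v v \<in> K" if "v \<in> K" for c v
      using that mult_mat_vec[OF Y, of v c] by (auto simp: K_def)
    show "\<sigma> g *\<^sub>v w \<in> K" if "g \<in> carrier G" "w \<in> K" for g w
    proof -
      have "Y *\<^sub>v (\<sigma> g *\<^sub>v w) = \<rho> g *\<^sub>v 0\<^sub>v d" using that intv[OF that(1), of w] by (simp add: K_def)
      also have "\<dots> = 0\<^sub>v d" using \<rho>c[OF that(1)] by (intro eq_vecI) auto
      finally show ?thesis using that \<sigma>c[OF that(1)] by (simp add: K_def)
    qed
  qed (use Y in \<open>auto simp: K_def intro!: eq_vecI\<close>)
  then have "K = {0\<^sub>v e} \<or> K = carrier_vec e"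
    using \<sigma> by (simp add: irreducible_representation_def)
  moreover have "unit_vec e j \<notin> K" using Yj by (simp add: K_def)
  ultimately have K0: "K = {0\<^sub>v e}" by auto
  have "invariant_subspace G d \<rho> I"
  proof (rule invariant_subspaceI)
    show "I \<subseteq> carrier_vec d" using Y by (auto simp: I_def)
    have "Y *\<^sub>v 0\<^sub>v e = 0\<^sub>v d" using Y by (intro eq_vecI) auto
    then show "0\<^sub>v d \<in> I" unfolding I_def by (metis imageI zero_carrier_vec)
    show "v + w \<in> I" if v: "v \<in> I" and w: "w \<in> I" for v w
    proof -
      obtain x y where "x \<in> carrier_vec e" "v = Y *\<^sub>v x" "y \<in> carrier_vec e" "w = Y *\<^sub>v y"
        using v w by (auto simp: I_def)
      then show ?thesis unfolding I_def
        using mult_add_distrib_mat_vec[OF Y, of x y] by (intro image_eqI[of _ _ "x + y"]) auto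
    qed
    show "c \<cdot>\<^sub>v v \<in> I" if v: "v \<in> I" for c v
    proof -
      obtain x where "x \<in> carrier_vec e" "v = Y *\<^sub>v x" using v by (auto simp: I_def)
      then show ?thesis unfolding I_def
        using mult_mat_vec[OF Y, of x c] by (intro image_eqI[of _ _ "c \<cdot>\<^sub>v x"]) auto
    qed
    show "\<rho> g *\<^sub>v w \<in> I" if g: "g \<in> carrier G" and w: "w \<in> I" for g w
    proof -
      obtain x where "x \<in> carrier_vec e" "w = Y *\<^sub>v x" using w by (auto simp: I_def)
      then show ?thesis unfolding I_def
        using intv[OF g, of x] \<sigma>c[OF g] by (intro image_eqI[of _ _ "\<sigma> g *\<^sub>v x"]) auto
    qed
  qed
  then have "I = {0\<^sub>v d} \<or> I = carrier_vec d"
    using \<rho> by (simp add: irreducible_representation_def)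
  moreover have "Y *\<^sub>v unit_vec e j \<in> I" by (simp add: I_def)
  ultimately have I1: "I = carrier_vec d" using Yj by auto
  \<comment> \<open>Surjectivity: preimages of the unit vectors are the columns of a right inverse
    \<open>X\<close>. That \<open>X\<close> is also a left inverse comes from injectivity, since
    \<open>Y * (X * Y) = Y\<close>.\<close>
  have "\<exists>x. x \<in> carrier_vec e \<and> unit_vec d i = Y *\<^sub>v x" for i
  proof -
    have "unit_vec d i \<in> I" using I1 by simp
    then show ?thesis by (auto simp: I_def)
  qed
  then obtain x where x: "\<And>i. x i \<in> carrier_vec e \<and> unit_vec d i = Y *\<^sub>v x i" by metis
  define X where "X = mat_of_cols e (map x [0..<d])"
  have X: "X \<in> carrier_mat e d" using mat_of_cols_carrier(1)[of e "map x [0..<d]"] by (simp add: X_def)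
  have "col X i = x i" if "i < d" for i
    using that x unfolding X_def by (subst col_mat_of_cols) auto
  then have "col (Y * X) i = unit_vec d i" if "i < d" for i
    using that x col_mult2[OF Y X that] by metis
  then have YX: "Y * X = 1\<^sub>m d"
    using Y X by (intro mat_col_eqI) auto
  have XYc: "X * Y \<in> carrier_mat e e" using X Y by simp
  have XY: "X * Y = 1\<^sub>m e"
  proof (rule mat_col_eqI)
    fix i assume "i < dim_col (1\<^sub>m e :: complex mat)"
    then have i: "i < e" by simp
    let ?z = "col (X * Y) i - unit_vec e i"
    have "Y *\<^sub>v col (X * Y) i = col (Y * (X * Y)) i" using col_mult2[OF Y XYc i] by simp
    also have "Y * (X * Y) = Y" using assoc_mult_mat[OF Y X Y] YX Y by simp
    also have "col Y i = Y *\<^sub>v unit_vec e i" using mult_unit_vec_col[OF Y i] by simp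
    finally have eq: "Y *\<^sub>v col (X * Y) i = Y *\<^sub>v unit_vec e i" .
    have c: "col (X * Y) i \<in> carrier_vec e" using X by (intro carrier_vecI) simp
    have "Y *\<^sub>v ?z = Y *\<^sub>v col (X * Y) i - Y *\<^sub>v unit_vec e i"
      by (rule mult_minus_distrib_mat_vec[OF Y c]) simp
    also have "\<dots> = 0\<^sub>v d" unfolding eq using Y by (intro eq_vecI) auto
    finally have "?z \<in> K" using c by (simp add: K_def)
    then have z: "?z = 0\<^sub>v e" using K0 by simp
    have "col (X * Y) i = unit_vec e i"
    proof (rule eq_vecI)
      fix l assume "l < dim_vec (unit_vec e i :: complex vec)"
      then have "(col (X * Y) i - unit_vec e i) $ l = col (X * Y) i $ l - unit_vec e i $ l" "l < e"
        by (auto intro: index_minus_vec)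
      then show "col (X * Y) i $ l = unit_vec e i $ l" unfolding z by simp
    qed (use X in simp)
    then show "col (X * Y) i = col (1\<^sub>m e) i" using i by simp
  qed (use XYc in auto)
  show thesis by (rule that[OF X YX XY])
qed

text \<open>A nonzero intertwiner conjugates one representation into the other. Used in
  contraposition: if the characters differ somewhere, every intertwiner is zero.\<close>

lemma irreducible_intertwiner_trace:
  assumes \<rho>: "irreducible_representation G d \<rho>" and \<sigma>: "irreducible_representation G e \<sigma>"
    and Y: "Y \<in> carrier_mat d e" and int: "\<And>g. g \<in> carrier G \<Longrightarrow> \<rho> g * Y = Y * \<sigma> g"
    and nz: "Y \<noteq> 0\<^sub>m d e" and g: "g \<in> carrier G"
  shows "mat_trace (\<rho> g) = mat_trace (\<sigma> g)"
proof -
  obtain X where X: "X \<in> carrier_mat e d" "Y * X = 1\<^sub>m d" "X * Y = 1\<^sub>m e"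
    using irreducible_intertwiner[OF assms(1-5)] by metis
  have R: "\<rho> g \<in> carrier_mat d d" and S: "\<sigma> g \<in> carrier_mat e e"
    using \<rho> \<sigma> g by (auto simp: irreducible_representation_def representation_iff)
  have "\<rho> g = (\<rho> g * Y) * X" using assoc_mult_mat[OF R Y X(1)] X R by simp
  also have "mat_trace \<dots> = mat_trace (X * (\<rho> g * Y))"
    by (rule mat_trace_mult_commute[of _ d e]) (use R Y X in auto)
  also have "X * (\<rho> g * Y) = \<sigma> g"
    unfolding int[OF g] using assoc_mult_mat[OF X(1) Y S] X S by simp
  finally show ?thesis .
qed

text \<open>Over the complex numbers \<open>Y\<close> has an eigenvalue \<open>c\<close>. Then
  \<open>Y - c\<close> is again an intertwiner and kills an eigenvector, so it is not invertible and
  must be zero.\<close>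

lemma irreducible_self_intertwiner:
  assumes \<rho>: "irreducible_representation G d \<rho>"
    and Y: "Y \<in> carrier_mat d d" and int: "\<And>g. g \<in> carrier G \<Longrightarrow> \<rho> g * Y = Y * \<rho> g"
  obtains c where "Y = c \<cdot>\<^sub>m 1\<^sub>m d"
proof -
  have d: "d > 0" and \<rho>c: "\<And>g. g \<in> carrier G \<Longrightarrow> \<rho> g \<in> carrier_mat d d"
    using \<rho> by (auto simp: irreducible_representation_def representation_iff)
  obtain c where "c \<in> spectrum Y" using spectrum_non_empty[OF Y d] by auto
  then obtain v where v: "v \<in> carrier_vec d" "v \<noteq> 0\<^sub>v d" "Y *\<^sub>v v = c \<cdot>\<^sub>v v"
    using Y by (auto simp: spectrum_def eigenvalue_def eigenvector_def)
  define Z where "Z = Y - c \<cdot>\<^sub>m 1\<^sub>m d"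
  have Z: "Z \<in> carrier_mat d d" unfolding Z_def using Y by (intro minus_carrier_mat) simp
  have "Z = 0\<^sub>m d d"
  proof (rule ccontr)
    assume nz: "Z \<noteq> 0\<^sub>m d d"
    have "\<rho> g * Z = Z * \<rho> g" if g: "g \<in> carrier G" for g
    proof -
      note R = \<rho>c[OF g]
      have "\<rho> g * Z = \<rho> g * Y - \<rho> g * (c \<cdot>\<^sub>m 1\<^sub>m d)"
        unfolding Z_def by (rule mult_minus_distrib_mat[OF R Y]) simp
      also have "\<rho> g * (c \<cdot>\<^sub>m 1\<^sub>m d) = (c \<cdot>\<^sub>m 1\<^sub>m d) * \<rho> g"
        using R by (simp add: mult_smult_distrib[OF R one_carrier_mat] mult_smult_assoc_mat[OF one_carrier_mat R])
      also have "\<rho> g * Y - (c \<cdot>\<^sub>m 1\<^sub>m d) * \<rho> g = Z * \<rho> g"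
        unfolding Z_def int[OF g] by (rule minus_mult_distrib_mat[OF Y _ R, symmetric]) simp
      finally show ?thesis .
    qed
    then obtain X where X: "X \<in> carrier_mat d d" "X * Z = 1\<^sub>m d"
      using irreducible_intertwiner[OF \<rho> \<rho> Z _ nz] by metis
    have "Z *\<^sub>v v = Y *\<^sub>v v - (c \<cdot>\<^sub>m 1\<^sub>m d) *\<^sub>v v"
      unfolding Z_def by (rule minus_mult_distrib_mat_vec[OF Y _ v(1)]) simp
    also have "(c \<cdot>\<^sub>m 1\<^sub>m d) *\<^sub>v v = c \<cdot>\<^sub>v v"
      using v(1) by (intro eq_vecI) (auto simp: scalar_prod_def if_distrib if_distribR cong: if_cong)
    also have "Y *\<^sub>v v - c \<cdot>\<^sub>v v = 0\<^sub>v d" unfolding v(3) using v(1) by (intro eq_vecI) auto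
    finally have Zv: "Z *\<^sub>v v = 0\<^sub>v d" .
    have "v = X *\<^sub>v (Z *\<^sub>v v)" using assoc_mult_mat_vec[OF X(1) Z v(1)] X v by simp
    also have "\<dots> = 0\<^sub>v d" unfolding Zv using X by (intro eq_vecI) auto
    finally show False using v by simp
  qed
  then have "Y = c \<cdot>\<^sub>m 1\<^sub>m d"
  proof (intro eq_matI)
    fix i j assume "i < dim_row (c \<cdot>\<^sub>m 1\<^sub>m d)" "j < dim_col (c \<cdot>\<^sub>m 1\<^sub>m d)"
    then have ij: "i < d" "j < d" by auto
    have "Z $$ (i,j) = Y $$ (i,j) - (c \<cdot>\<^sub>m 1\<^sub>m d) $$ (i,j)" using ij Y by (simp add: Z_def)
    then show "Y $$ (i,j) = (c \<cdot>\<^sub>m 1\<^sub>m d) $$ (i,j)" using ij \<open>Z = 0\<^sub>m d d\<close> by simp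
  qed (use Y in auto)
  then show thesis by (rule that)
qed

text \<open>\<open>Y\<close> is the sum over the group of
  \<open>\<rho> g * E * \<sigma> (inv g)\<close>, where \<open>E\<close> is the matrix unit at
  \<open>(k,l)\<close>; the substitution of \<open>h \<otimes> g\<close> for \<open>g\<close> moves
  \<open>h\<close> from one side to the other.\<close>

lemma matrix_coefficient_sum_intertwines:
  fixes G (structure)
  assumes fin: "finite (carrier G)"
    and \<rho>: "representation G d \<rho>" and \<sigma>: "representation G e \<sigma>" and k: "k < d" and l: "l < e"
    and h: "h \<in> carrier G"
  defines "Y \<equiv> mat d e (\<lambda>(i,j). \<Sum>g\<in>carrier G. \<rho> g $$ (i,k) * \<sigma> (inv g) $$ (l,j))"
  shows "\<rho> h * Y = Y * \<sigma> h"
proof (rule eq_matI)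
  interpret group G using \<rho> by (simp add: representation_iff)
  have \<rho>c: "\<rho> g \<in> carrier_mat d d" and \<sigma>c: "\<sigma> g \<in> carrier_mat e e" if "g \<in> carrier G" for g
    using \<rho> \<sigma> that by (auto simp: representation_iff)
  have \<rho>m: "\<rho> (g \<otimes> h) = \<rho> g * \<rho> h" and \<sigma>m: "\<sigma> (g \<otimes> h) = \<sigma> g * \<sigma> h"
    if "g \<in> carrier G" "h \<in> carrier G" for g h
    using \<rho> \<sigma> that by (auto simp: representation_iff)
  fix i j assume "i < dim_row (Y * \<sigma> h)" "j < dim_col (Y * \<sigma> h)"
  then have i: "i < d" and j: "j < e" using \<sigma>c[OF h] by (auto simp: Y_def)
  have "(\<rho> h * Y) $$ (i,j) = (\<Sum>p<d. \<rho> h $$ (i,p) * (\<Sum>g\<in>carrier G. \<rho> g $$ (p,k) * \<sigma> (inv g) $$ (l,j)))"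
    using i j \<rho>c[OF h] by (auto simp: Y_def scalar_prod_def atLeast0LessThan intro!: sum.cong)
  also have "\<dots> = (\<Sum>g\<in>carrier G. (\<Sum>p<d. \<rho> h $$ (i,p) * \<rho> g $$ (p,k)) * \<sigma> (inv g) $$ (l,j))"
    unfolding sum_distrib_left sum_distrib_right by (subst sum.swap) (simp add: mult.assoc)
  also have "\<dots> = (\<Sum>g\<in>carrier G. \<rho> (h \<otimes> g) $$ (i,k) * \<sigma> (inv g) $$ (l,j))"
  proof (rule sum.cong[OF refl])
    fix g assume g: "g \<in> carrier G"
    show "(\<Sum>p<d. \<rho> h $$ (i,p) * \<rho> g $$ (p,k)) * \<sigma> (inv g) $$ (l,j)
        = \<rho> (h \<otimes> g) $$ (i,k) * \<sigma> (inv g) $$ (l,j)"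
      using \<rho>c[OF h] \<rho>c[OF g] i k by (simp add: \<rho>m[OF h g] scalar_prod_def atLeast0LessThan)
  qed
  \<comment> \<open>Writing \<open>inv g\<close> as \<open>inv (h \<otimes> g) \<otimes> h\<close>
    makes the summand a function of \<open>h \<otimes> g\<close>, ready for reindexing.\<close>
  also have "\<dots> = (\<Sum>g\<in>carrier G. \<rho> (h \<otimes> g) $$ (i,k) * \<sigma> (inv (h \<otimes> g) \<otimes> h) $$ (l,j))"
    using h by (intro sum.cong) (auto simp: inv_mult_group m_assoc)
  also have "\<dots> = (\<Sum>g\<in>carrier G. \<rho> g $$ (i,k) * \<sigma> (inv g \<otimes> h) $$ (l,j))"
    by (rule sum.reindex_bij_witness[of _ "\<lambda>g. inv h \<otimes> g" "\<lambda>g. h \<otimes> g"])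
      (use h in \<open>auto simp: m_assoc[symmetric]\<close>)
  also have "\<dots> = (\<Sum>g\<in>carrier G. \<rho> g $$ (i,k) * (\<Sum>q<e. \<sigma> (inv g) $$ (l,q) * \<sigma> h $$ (q,j)))"
  proof (rule sum.cong[OF refl])
    fix g assume g: "g \<in> carrier G"
    show "\<rho> g $$ (i,k) * \<sigma> (inv g \<otimes> h) $$ (l,j)
        = \<rho> g $$ (i,k) * (\<Sum>q<e. \<sigma> (inv g) $$ (l,q) * \<sigma> h $$ (q,j))"
      using \<sigma>c[OF h] \<sigma>c[OF inv_closed[OF g]] j l
      by (simp add: \<sigma>m[OF inv_closed[OF g] h] scalar_prod_def atLeast0LessThan)
  qed
  also have "\<dots> = (\<Sum>q<e. (\<Sum>g\<in>carrier G. \<rho> g $$ (i,k) * \<sigma> (inv g) $$ (l,q)) * \<sigma> h $$ (q,j))"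
    unfolding sum_distrib_left sum_distrib_right by (subst sum.swap) (simp add: mult.assoc)
  also have "\<dots> = (Y * \<sigma> h) $$ (i,j)"
    using i j \<sigma>c[OF h] by (auto simp: Y_def scalar_prod_def atLeast0LessThan intro!: sum.cong)
  finally show "(\<rho> h * Y) $$ (i,j) = (Y * \<sigma> h) $$ (i,j)" .
qed (use assms in \<open>auto simp: representation_iff Y_def\<close>)

lemma character_pairing_coefficients:
  fixes G (structure)
  assumes "representation G d \<rho>" "representation G e \<sigma>"
  shows "(\<Sum>g\<in>carrier G. mat_trace (\<rho> g) * mat_trace (\<sigma> (inv g)))
    = (\<Sum>k<d. \<Sum>l<e. \<Sum>g\<in>carrier G. \<rho> g $$ (k,k) * \<sigma> (inv g) $$ (l,l))"
proof -
  interpret group G using assms by (simp add: representation_iff)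
  have "mat_trace (\<rho> g) * mat_trace (\<sigma> (inv g)) = (\<Sum>k<d. \<Sum>l<e. \<rho> g $$ (k,k) * \<sigma> (inv g) $$ (l,l))"
    if "g \<in> carrier G" for g
  proof -
    have "dim_row (\<rho> g) = d" "dim_row (\<sigma> (inv g)) = e"
      using assms that by (auto simp: representation_iff)
    then show ?thesis by (simp add: mat_trace_def sum_product)
  qed
  then have "(\<Sum>g\<in>carrier G. mat_trace (\<rho> g) * mat_trace (\<sigma> (inv g)))
      = (\<Sum>g\<in>carrier G. \<Sum>k<d. \<Sum>l<e. \<rho> g $$ (k,k) * \<sigma> (inv g) $$ (l,l))"
    by (rule sum.cong[OF refl])
  also have "\<dots> = (\<Sum>k<d. \<Sum>g\<in>carrier G. \<Sum>l<e. \<rho> g $$ (k,k) * \<sigma> (inv g) $$ (l,l))"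
    by (rule sum.swap)
  also have "\<dots> = (\<Sum>k<d. \<Sum>l<e. \<Sum>g\<in>carrier G. \<rho> g $$ (k,k) * \<sigma> (inv g) $$ (l,l))"
    by (rule sum.cong[OF refl sum.swap])
  finally show ?thesis .
qed

text \<open>The pairing is the sum over \<open>k\<close> and \<open>l\<close> of the entry
  \<open>(k,l)\<close> of the intertwiner averaged from the matrix unit at \<open>(k,l)\<close>, and
  all these intertwiners vanish. With \<open>\<psi> (inv g)\<close> in place of a complex conjugate
  no invariant inner product is involved.\<close>

lemma irreducible_characters_orthogonal:
  fixes G (structure)
  assumes fin: "finite (carrier G)" and \<chi>: "irreducible_character G \<chi>" and \<psi>: "irreducible_character G \<psi>"
    and ne: "\<exists>g\<in>carrier G. \<chi> g \<noteq> \<psi> g"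
  shows "(\<Sum>g\<in>carrier G. \<chi> g * \<psi> (inv g)) = 0"
proof -
  obtain d \<rho> where \<rho>: "irreducible_representation G d \<rho>" "\<And>g. g \<in> carrier G \<Longrightarrow> \<chi> g = mat_trace (\<rho> g)"
    using \<chi> by (auto simp: irreducible_character_def)
  obtain e \<sigma> where \<sigma>: "irreducible_representation G e \<sigma>" "\<And>g. g \<in> carrier G \<Longrightarrow> \<psi> g = mat_trace (\<sigma> g)"
    using \<psi> by (auto simp: irreducible_character_def)
  have rep: "representation G d \<rho>" "representation G e \<sigma>"
    using \<rho> \<sigma> by (auto simp: irreducible_representation_def)
  interpret group G using rep by (simp add: representation_iff)
  have 0: "(\<Sum>g\<in>carrier G. \<rho> g $$ (k,k) * \<sigma> (inv g) $$ (l,l)) = 0" if k: "k < d" and l: "l < e" for k l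
  proof -
    define Y where "Y = mat d e (\<lambda>(i,j). \<Sum>g\<in>carrier G. \<rho> g $$ (i,k) * \<sigma> (inv g) $$ (l,j))"
    have int: "\<rho> h * Y = Y * \<sigma> h" if "h \<in> carrier G" for h
      unfolding Y_def by (rule matrix_coefficient_sum_intertwines[OF fin rep k l that])
    have Y: "Y \<in> carrier_mat d e" by (simp add: Y_def)
    have "Y = 0\<^sub>m d e"
    proof (rule ccontr)
      assume "Y \<noteq> 0\<^sub>m d e"
      from irreducible_intertwiner_trace[OF \<rho>(1) \<sigma>(1) Y int this] show False
        using ne \<rho>(2) \<sigma>(2) by simp
    qed
    then have "Y $$ (k,l) = 0" using k l by simp
    then show ?thesis using k l by (simp add: Y_def)
  qed
  have "(\<Sum>g\<in>carrier G. \<chi> g * \<psi> (inv g)) = (\<Sum>g\<in>carrier G. mat_trace (\<rho> g) * mat_trace (\<sigma> (inv g)))"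
    using \<rho>(2) \<sigma>(2) by simp
  also have "\<dots> = 0"
    unfolding character_pairing_coefficients[OF rep] using 0 by simp
  finally show ?thesis .
qed

text \<open>The averaged intertwiner is now a scalar matrix. Its trace determines the scalar: the
  group order divided by \<open>d\<close> for \<open>k = l\<close>, and 0 otherwise. Only the
  \<open>d\<close> diagonal pairs contribute to the pairing.\<close>

lemma irreducible_character_norm:
  fixes G (structure)
  assumes fin: "finite (carrier G)" and \<chi>: "irreducible_character G \<chi>"
  shows "(\<Sum>g\<in>carrier G. \<chi> g * \<chi> (inv g)) = of_nat (card (carrier G))"
proof -
  obtain d \<rho> where \<rho>: "irreducible_representation G d \<rho>" "\<And>g. g \<in> carrier G \<Longrightarrow> \<chi> g = mat_trace (\<rho> g)"
    using \<chi> by (auto simp: irreducible_character_def)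
  have rep: "representation G d \<rho>" and d: "d > 0"
    using \<rho> by (auto simp: irreducible_representation_def)
  interpret group G using rep by (simp add: representation_iff)
  have \<rho>c: "\<rho> g \<in> carrier_mat d d" if "g \<in> carrier G" for g
    using rep that by (auto simp: representation_iff)
  let ?N = "of_nat (card (carrier G)) :: complex"
  have 0: "(\<Sum>g\<in>carrier G. \<rho> g $$ (k,k) * \<rho> (inv g) $$ (l,l)) = (if k = l then ?N / of_nat d else 0)"
    if k: "k < d" and l: "l < d" for k l
  proof -
    define Y where "Y = mat d d (\<lambda>(i,j). \<Sum>g\<in>carrier G. \<rho> g $$ (i,k) * \<rho> (inv g) $$ (l,j))"
    have int: "\<rho> h * Y = Y * \<rho> h" if "h \<in> carrier G" for h
      unfolding Y_def by (rule matrix_coefficient_sum_intertwines[OF fin rep rep k l that])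
    have Y: "Y \<in> carrier_mat d d" by (simp add: Y_def)
    obtain c where c: "Y = c \<cdot>\<^sub>m 1\<^sub>m d"
      by (rule irreducible_self_intertwiner[OF \<rho>(1) Y int])
    \<comment> \<open>Inside the trace, the sum over \<open>i\<close> composes
      \<open>\<rho> (inv g)\<close> with \<open>\<rho> g\<close>, leaving the entry
      \<open>(l,k)\<close> of the identity for each \<open>g\<close>.\<close>
    have "of_nat d * c = (\<Sum>i<d. Y $$ (i,i))" by (simp add: c)
    also have "\<dots> = (\<Sum>i<d. \<Sum>g\<in>carrier G. \<rho> g $$ (i,k) * \<rho> (inv g) $$ (l,i))"
      by (simp add: Y_def)
    also have "\<dots> = (\<Sum>g\<in>carrier G. \<Sum>i<d. \<rho> (inv g) $$ (l,i) * \<rho> g $$ (i,k))"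
      by (subst sum.swap) (simp add: mult.commute)
    also have "\<dots> = (\<Sum>g\<in>carrier G. if k = l then 1 else 0)"
    proof (rule sum.cong[OF refl])
      fix g assume g: "g \<in> carrier G"
      have "(\<Sum>i<d. \<rho> (inv g) $$ (l,i) * \<rho> g $$ (i,k)) = (\<rho> (inv g) * \<rho> g) $$ (l,k)"
        using \<rho>c[OF g] \<rho>c[OF inv_closed[OF g]] k l by (simp add: scalar_prod_def atLeast0LessThan)
      also have "\<rho> (inv g) * \<rho> g = 1\<^sub>m d"
        using rep g by (metis inv_closed l_inv representation_iff)
      finally show "(\<Sum>i<d. \<rho> (inv g) $$ (l,i) * \<rho> g $$ (i,k)) = (if k = l then 1 else 0)"
        using k l by auto
    qed
    also have "\<dots> = (if k = l then ?N else 0)" by simp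
    finally have "c = (if k = l then ?N / of_nat d else 0)"
      using d by (auto simp: field_simps split: if_splits)
    moreover have "(\<Sum>g\<in>carrier G. \<rho> g $$ (k,k) * \<rho> (inv g) $$ (l,l)) = Y $$ (k,l)"
      using k l by (simp add: Y_def)
    ultimately show ?thesis using k l by (auto simp: c)
  qed
  have "(\<Sum>g\<in>carrier G. \<chi> g * \<chi> (inv g)) = (\<Sum>g\<in>carrier G. mat_trace (\<rho> g) * mat_trace (\<rho> (inv g)))"
    using \<rho>(2) by simp
  also have "\<dots> = (\<Sum>k<d. \<Sum>l<d. if k = l then ?N / of_nat d else 0)"
    unfolding character_pairing_coefficients[OF rep rep] using 0 by simp
  also have "\<dots> = ?N" using d by simp
  finally show ?thesis .
qed

text \<open>Orthogonality turns the norm into the sum of the squares of the integer multiplicities.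
  If that sum is 1, exactly one multiplicity is nonzero, and it is 1 or -1.\<close>

theorem virtual_character_norm_one:
  fixes G (structure)
  assumes grp: "group G" and fin: "finite (carrier G)" and f: "virtual_character G f"
    and norm: "(\<Sum>g\<in>carrier G. f g * f (inv g)) = of_nat (card (carrier G))"
  obtains \<chi> and s :: int where "irreducible_character G \<chi>" "\<bar>s\<bar> = 1" "\<And>g. g \<in> carrier G \<Longrightarrow> f g = of_int s * \<chi> g"
proof -
  interpret group G by fact
  obtain F and m :: "_ \<Rightarrow> int" where F': "finite F"
    "\<forall>\<chi>\<in>F. irreducible_character G \<chi> \<and> (\<forall>g. g \<notin> carrier G \<longrightarrow> \<chi> g = 0)"
    "\<forall>g\<in>carrier G. f g = (\<Sum>\<chi>\<in>F. of_int (m \<chi>) * \<chi> g)"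
    using f unfolding virtual_character_def by blast
  then have F: "finite F"
    "\<And>\<chi>. \<chi> \<in> F \<Longrightarrow> irreducible_character G \<chi>" "\<And>\<chi> g. \<chi> \<in> F \<Longrightarrow> g \<notin> carrier G \<Longrightarrow> \<chi> g = 0"
    "\<And>g. g \<in> carrier G \<Longrightarrow> f g = (\<Sum>\<chi>\<in>F. of_int (m \<chi>) * \<chi> g)"
    by simp_all
  let ?N = "of_nat (card (carrier G)) :: complex"
  have N0: "?N \<noteq> 0" using fin one_closed by auto
  have orth: "(\<Sum>g\<in>carrier G. \<chi> g * \<psi> (inv g)) = (if \<chi> = \<psi> then ?N else 0)"
    if \<chi>: "\<chi> \<in> F" and \<psi>: "\<psi> \<in> F" for \<chi> \<psi>
  proof (cases "\<chi> = \<psi>")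
    case True
    then show ?thesis using irreducible_character_norm[OF fin F(2)[OF \<chi>]] by simp
  next
    case False
    then obtain g where g: "\<chi> g \<noteq> \<psi> g" by blast
    then have "g \<in> carrier G" using F(3) \<chi> \<psi> by metis
    then show ?thesis using irreducible_characters_orthogonal[OF fin F(2)[OF \<chi>] F(2)[OF \<psi>]] g False by auto
  qed
  have "?N = (\<Sum>g\<in>carrier G. \<Sum>\<chi>\<in>F. \<Sum>\<psi>\<in>F. of_int (m \<chi> * m \<psi>) * (\<chi> g * \<psi> (inv g)))"
    unfolding norm[symmetric]
    by (intro sum.cong refl) (simp add: F(4) sum_product mult.assoc mult.left_commute)
  also have "\<dots> = (\<Sum>\<chi>\<in>F. \<Sum>\<psi>\<in>F. of_int (m \<chi> * m \<psi>) * (\<Sum>g\<in>carrier G. \<chi> g * \<psi> (inv g)))"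
  proof -
    have "(\<Sum>g\<in>carrier G. \<Sum>\<chi>\<in>F. \<Sum>\<psi>\<in>F. h \<chi> \<psi> g)
        = (\<Sum>\<chi>\<in>F. \<Sum>\<psi>\<in>F. \<Sum>g\<in>carrier G. h \<chi> \<psi> g)" for h :: "_ \<Rightarrow> _ \<Rightarrow> _ \<Rightarrow> complex"
      by (subst sum.swap) (rule sum.cong[OF refl sum.swap])
    then show ?thesis unfolding sum_distrib_left .
  qed
  also have "\<dots> = (\<Sum>\<chi>\<in>F. \<Sum>\<psi>\<in>F. if \<chi> = \<psi> then of_int (m \<chi> * m \<psi>) * ?N else 0)"
    by (intro sum.cong refl) (simp add: orth)
  also have "\<dots> = of_int (\<Sum>\<chi>\<in>F. m \<chi> * m \<chi>) * ?N"
    using F(1) by (simp add: sum_distrib_right)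
  finally have "(of_int (\<Sum>\<chi>\<in>F. m \<chi> * m \<chi>) :: complex) = of_int 1" using N0 by simp
  then have sq: "(\<Sum>\<chi>\<in>F. m \<chi> * m \<chi>) = 1" by (simp only: of_int_eq_iff)
  have "\<exists>\<chi>\<in>F. m \<chi> \<noteq> 0"
  proof (rule ccontr)
    assume "\<not> ?thesis"
    then show False using sq by simp
  qed
  then obtain \<chi> where \<chi>: "\<chi> \<in> F" "m \<chi> \<noteq> 0" by blast
  have rest: "m \<chi> * m \<chi> + (\<Sum>\<psi>\<in>F - {\<chi>}. m \<psi> * m \<psi>) = 1"
    using sq sum.remove[OF F(1) \<chi>(1), of "\<lambda>\<chi>. m \<chi> * m \<chi>"] by simp
  have ge: "(\<Sum>\<psi>\<in>F - {\<chi>}. m \<psi> * m \<psi>) \<ge> 0" by (simp add: sum_nonneg)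
  have "m \<chi> * m \<chi> > 0" using \<chi>(2) by (simp add: zero_less_mult_iff) linarith
  then have one: "m \<chi> * m \<chi> = 1" "(\<Sum>\<psi>\<in>F - {\<chi>}. m \<psi> * m \<psi>) = 0" using rest ge by linarith+
  have z: "m \<psi> = 0" if "\<psi> \<in> F" "\<psi> \<noteq> \<chi>" for \<psi>
    using sum_nonneg_0[OF _ _ one(2), of \<psi>] that F(1) by simp
  have "f g = of_int (m \<chi>) * \<chi> g" if "g \<in> carrier G" for g
    unfolding F(4)[OF that] using sum.remove[OF F(1) \<chi>(1), of "\<lambda>\<chi>. of_int (m \<chi>) * \<chi> g"] z by simp
  moreover have "\<bar>m \<chi>\<bar> = 1" using one(1) by (simp add: zmult_eq_1_iff) auto
  ultimately show thesis using that[OF F(2)[OF \<chi>(1)]] by blast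
qed

section \<open>Permutation characters\<close>

lemma permutation_character_virtual:
  fixes G (structure)
  assumes "group_action G E \<phi>" "finite E"
  shows "virtual_character G (\<lambda>g. of_nat (card (invariants E \<phi> g)))"
proof -
  interpret group_action G E \<phi> by fact
  interpret group G using group_hom by (simp add: group_hom_def)
  let ?N = "card E"
  obtain e where e: "bij_betw e {..<?N} E"
    using ex_bij_betw_nat_finite[OF assms(2)] by (auto simp: atLeast0LessThan)
  have eE: "e i \<in> E" if "i < ?N" for i using bij_betwE[OF e] that by auto
  have einj: "e i = e j \<longleftrightarrow> i = j" if "i < ?N" "j < ?N" for i j
    using e that by (auto simp: bij_betw_def inj_on_def)
  define \<rho> where "\<rho> g = mat ?N ?N (\<lambda>(i,j). if e i = \<phi> g (e j) then 1 else 0 :: complex)" for g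
  have "representation G ?N \<rho>"
    unfolding representation_iff
  proof (intro conjI ballI)
    fix g h assume g: "g \<in> carrier G" and h: "h \<in> carrier G"
    show "\<rho> (g \<otimes> h) = \<rho> g * \<rho> h"
    proof (rule eq_matI)
      fix i j assume "i < dim_row (\<rho> g * \<rho> h)" "j < dim_col (\<rho> g * \<rho> h)"
      then have i: "i < ?N" and j: "j < ?N" by (auto simp: \<rho>_def)
      have "\<phi> h (e j) \<in> E" using element_image[OF h eE[OF j]] by simp
      \<comment> \<open>Column \<open>j\<close> of the permutation matrix of \<open>h\<close> has
        its only 1 in row \<open>l\<close>, so the matrix product collapses to the term
        \<open>p = l\<close>.\<close>
      then obtain l where l: "l < ?N" "e l = \<phi> h (e j)"
        using e by (force simp: bij_betw_def)
      have "(\<rho> g * \<rho> h) $$ (i,j) = (\<Sum>p<?N. (if e i = \<phi> g (e p) then 1 else 0) * (if e p = e l then 1 else 0))"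
        using i j by (simp add: \<rho>_def scalar_prod_def atLeast0LessThan l)
      also have "\<dots> = (\<Sum>p<?N. if p = l then (if e i = \<phi> g (e p) then 1 else 0) else 0)"
        using einj[OF _ l(1)] by (intro sum.cong) (simp_all del: l)
      also have "\<dots> = (if e i = \<phi> g (e l) then 1 else 0)" using l by simp
      also have "\<dots> = \<rho> (g \<otimes> h) $$ (i,j)"
        using i j composition_rule[OF eE[OF j] g h] by (simp add: \<rho>_def l)
      finally show "\<rho> (g \<otimes> h) $$ (i,j) = (\<rho> g * \<rho> h) $$ (i,j)" by simp
    qed (auto simp: \<rho>_def)
  next
    have "\<phi> \<one> x = x" if "x \<in> E" for x using id_eq_one that by (metis restrict_apply')
    then show "\<rho> \<one> = 1\<^sub>m ?N" using einj eE by (intro eq_matI) (auto simp: \<rho>_def)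
  qed (auto simp: \<rho>_def is_group)
  then have "virtual_character G (\<lambda>g. mat_trace (\<rho> g))"
    by (rule virtual_character_representation)
  moreover have "mat_trace (\<rho> g) = of_nat (card (invariants E \<phi> g))" for g
  proof -
    have "e ` {i\<in>{..<?N}. e i = \<phi> g (e i)} = invariants E \<phi> g"
    proof (intro equalityI subsetI)
      fix x assume "x \<in> e ` {i\<in>{..<?N}. e i = \<phi> g (e i)}"
      then show "x \<in> invariants E \<phi> g" using eE by (auto simp: invariants_def)
    next
      fix x assume x: "x \<in> invariants E \<phi> g"
      then have "x \<in> e ` {..<?N}" using bij_betw_imp_surj_on[OF e] by (simp add: invariants_def)
      then show "x \<in> e ` {i\<in>{..<?N}. e i = \<phi> g (e i)}" using x by (auto simp: invariants_def)
    qed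
    moreover have "inj_on e {i\<in>{..<?N}. e i = \<phi> g (e i)}"
      using bij_betw_imp_inj_on[OF e] by (rule inj_on_subset) auto
    ultimately have "card {i\<in>{..<?N}. e i = \<phi> g (e i)} = card (invariants E \<phi> g)"
      by (metis card_image)
    moreover have "mat_trace (\<rho> g) = of_nat (card {i\<in>{..<?N}. e i = \<phi> g (e i)})"
      by (simp add: mat_trace_def \<rho>_def sum.If_cases Int_def)
    ultimately show ?thesis by simp
  qed
  ultimately show ?thesis by simp
qed

section \<open>Signed counts of matrices\<close>

text \<open>The support condition makes a matrix and its function determine each other. Indexing by
  pairs lets a matrix serve later as the content of a word whose letters are pairs.\<close>

definition column_matrices :: "nat \<Rightarrow> nat set \<Rightarrow> (nat \<Rightarrow> nat) \<Rightarrow> (nat \<times> nat \<Rightarrow> nat) set"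
  where "column_matrices k J \<beta> = {A. (\<forall>i j. A (i,j) \<noteq> 0 \<longrightarrow> i < k \<and> j \<in> J) \<and>
    (\<forall>j\<in>J. (\<Sum>i<k. A (i,j)) = \<beta> j)}"

text \<open>A pair \<open>(v,A)\<close> selects the monomial of exponents \<open>v i\<close> in the
  Vandermonde determinant and, for each \<open>j\<close>, the monomial of exponents
  \<open>A (i,j)\<close> in the complete homogeneous polynomial of degree \<open>\<beta> j\<close>.
  The last condition says that their product is x^t.\<close>

definition shifted_matrices ::
    "nat \<Rightarrow> nat set \<Rightarrow> (nat \<Rightarrow> nat) \<Rightarrow> (nat \<Rightarrow> nat) \<Rightarrow> ((nat \<Rightarrow> nat) \<times> (nat \<times> nat \<Rightarrow> nat)) set"
  where "shifted_matrices k J \<beta> t = {(v,A). v permutes {..<k} \<and> A \<in> column_matrices k J \<beta> \<and>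
    (\<forall>i<k. v i + (\<Sum>j\<in>J. A (i,j)) = t i)}"

text \<open>With \<open>\<beta>\<close> restricted to \<open>J\<close>, the coefficient of \<open>x\<^sup>t\<close> in the product of the Vandermonde determinant
  and the complete homogeneous symmetric polynomials of degrees \<open>\<beta> j\<close>.\<close>

definition signed_count :: "nat \<Rightarrow> nat set \<Rightarrow> (nat \<Rightarrow> nat) \<Rightarrow> (nat \<Rightarrow> nat) \<Rightarrow> int"
  where "signed_count k J \<beta> t = (\<Sum>(v,A)\<in>shifted_matrices k J \<beta> t. sign v)"

lemma finite_column_matrices:
  assumes "finite J"
  shows "finite (column_matrices k J \<beta>)"
proof (rule finite_subset)
  let ?D = "{..<k} \<times> J" and ?T = "{..sum \<beta> J}"
  show "finite {A. \<forall>x. (x \<in> ?D \<longrightarrow> A x \<in> ?T) \<and> (x \<notin> ?D \<longrightarrow> A x = 0)}"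
    using assms by (intro finite_set_of_finite_funs) auto
  show "column_matrices k J \<beta> \<subseteq> {A. \<forall>x. (x \<in> ?D \<longrightarrow> A x \<in> ?T) \<and> (x \<notin> ?D \<longrightarrow> A x = 0)}"
  proof (intro subsetI CollectI allI conjI impI)
    fix A x assume A: "A \<in> column_matrices k J \<beta>"
    show "A x = 0" if "x \<notin> ?D" using A that by (cases x) (auto simp: column_matrices_def)
    assume x: "x \<in> ?D"
    then obtain i j where ij: "x = (i,j)" "i < k" "j \<in> J" by auto
    have "A (i,j) \<le> (\<Sum>i<k. A (i,j))" using ij by (intro member_le_sum) auto
    also have "\<dots> = \<beta> j" using A ij by (simp add: column_matrices_def)
    also have "\<dots> \<le> sum \<beta> J" using ij assms by (intro member_le_sum) auto
    finally show "A x \<in> ?T" using ij by simp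
  qed
qed

lemma finite_shifted_matrices:
  assumes "finite J"
  shows "finite (shifted_matrices k J \<beta> t)"
  by (rule finite_subset[of _ "{v. v permutes {..<k}} \<times> column_matrices k J \<beta>"])
    (auto simp: shifted_matrices_def assms finite_column_matrices finite_permutations)

lemma signed_count_cong:
  assumes "\<And>i. i < k \<Longrightarrow> t i = t' i"
  shows "signed_count k J \<beta> t = signed_count k J \<beta> t'"
  using assms by (simp add: signed_count_def shifted_matrices_def)

text \<open>The Vandermonde determinant is alternating and the other factors are symmetric. On the
  terms: permuting the rows of \<open>A\<close> keeps the column sums, and composing
  \<open>v\<close> with the transposition flips its sign.\<close>

lemma signed_count_transpose:
  assumes a: "a < k" and b: "b < k" and ab: "a \<noteq> b"
  shows "signed_count k J \<beta> (t \<circ> transpose a b) = - signed_count k J \<beta> t"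
proof -
  let ?\<tau> = "transpose a b"
  let ?f = "\<lambda>(v,A). (v \<circ> ?\<tau>, \<lambda>(i,j). A (?\<tau> i, j)) :: (nat \<Rightarrow> nat) \<times> (nat \<times> nat \<Rightarrow> nat)"
  have \<tau>: "?\<tau> permutes {..<k}" using a b by (intro permutes_swap_id) auto
  then have \<tau>k: "?\<tau> i < k \<longleftrightarrow> i < k" for i using permutes_in_image[OF \<tau>] by simp
  have sums: "(\<Sum>i<k. f (?\<tau> i)) = (\<Sum>i<k. f i)" for f :: "nat \<Rightarrow> nat"
    using sum.permute[OF \<tau>, of f] by (simp add: o_def)
  have col: "(\<lambda>(i,j). A (?\<tau> i, j)) \<in> column_matrices k J \<beta>" if "A \<in> column_matrices k J \<beta>" for A
  proof -
    have A: "\<And>i j. A (i,j) \<noteq> 0 \<Longrightarrow> i < k \<and> j \<in> J" "\<And>j. j \<in> J \<Longrightarrow> (\<Sum>i<k. A (i,j)) = \<beta> j"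
      using that by (auto simp: column_matrices_def)
    have "i < k \<and> j \<in> J" if "A (?\<tau> i, j) \<noteq> 0" for i j using A(1)[OF that] \<tau>k by simp
    moreover have "(\<Sum>i<k. A (?\<tau> i, j)) = \<beta> j" if "j \<in> J" for j
      using sums[of "\<lambda>i. A (i,j)"] A(2)[OF that] by simp
    ultimately show ?thesis by (simp add: column_matrices_def)
  qed
  have mem: "?f p \<in> shifted_matrices k J \<beta> (s \<circ> ?\<tau>)" if "p \<in> shifted_matrices k J \<beta> s" for p s
    using that \<tau> \<tau>k col by (auto simp: shifted_matrices_def permutes_compose)
  have ff: "?f (?f p) = p" for p by (cases p) (auto simp: fun_eq_iff)
  have "signed_count k J \<beta> (t \<circ> ?\<tau>) = (\<Sum>(v,A)\<in>shifted_matrices k J \<beta> t. - sign v)"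
    unfolding signed_count_def
  proof (rule sum.reindex_bij_witness[of _ ?f ?f])
    fix p assume p: "p \<in> shifted_matrices k J \<beta> (t \<circ> ?\<tau>)"
    show "?f (?f p) = p" by (rule ff)
    show "?f p \<in> shifted_matrices k J \<beta> t" using mem[OF p] by (simp add: o_assoc[symmetric])
    obtain v A where vA: "p = (v,A)" by (cases p)
    then have "permutation v" using p by (auto simp: shifted_matrices_def permutation_permutes)
    then have "sign (v \<circ> ?\<tau>) = - sign v"
      using ab by (simp add: sign_compose permutation_swap_id sign_swap_id)
    then show "(case ?f p of (v,A) \<Rightarrow> - sign v) = (case p of (v,A) \<Rightarrow> sign v)" by (simp add: vA)
  next
    fix p assume p: "p \<in> shifted_matrices k J \<beta> t"
    show "?f (?f p) = p" by (rule ff)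
    show "?f p \<in> shifted_matrices k J \<beta> (t \<circ> ?\<tau>)" using mem[OF p] .
  qed
  then show ?thesis by (simp add: signed_count_def case_prod_unfold sum_negf)
qed

text \<open>The exponents left after dividing x^t by a monomial of degree \<open>r\<close>: the
  Pieri rule before cancellation. Zero padding from \<open>k\<close> on makes \<open>\<mu>\<close>
  unique as a function.\<close>

definition removals :: "nat \<Rightarrow> nat \<Rightarrow> (nat \<Rightarrow> nat) \<Rightarrow> (nat \<Rightarrow> nat) set"
  where "removals k r t = {\<mu>. (\<forall>i\<ge>k. \<mu> i = 0) \<and> (\<forall>i<k. \<mu> i \<le> t i) \<and> (\<Sum>i<k. \<mu> i) + r = (\<Sum>i<k. t i)}"

lemma finite_removals: "finite (removals k r t)"
proof (rule finite_subset)
  let ?D = "{..<k}" and ?T = "{..\<Sum>i<k. t i}"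
  show "finite {A. \<forall>x. (x \<in> ?D \<longrightarrow> A x \<in> ?T) \<and> (x \<notin> ?D \<longrightarrow> A x = 0)}"
    by (intro finite_set_of_finite_funs) auto
  show "removals k r t \<subseteq> {A. \<forall>x. (x \<in> ?D \<longrightarrow> A x \<in> ?T) \<and> (x \<notin> ?D \<longrightarrow> A x = 0)}"
  proof (intro subsetI CollectI allI conjI impI)
    fix \<mu> x assume \<mu>: "\<mu> \<in> removals k r t"
    show "\<mu> x = 0" if "x \<notin> ?D" using \<mu> that by (simp add: removals_def)
    assume x: "x \<in> ?D"
    have "\<mu> x \<le> (\<Sum>i<k. \<mu> i)" using x by (intro member_le_sum) auto
    then show "\<mu> x \<in> ?T" using \<mu> by (simp add: removals_def)
  qed
qed

text \<open>Expansion along one column: \<open>t - \<mu>\<close> is the content of column \<open>j\<close>.\<close>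

lemma signed_count_insert:
  assumes J: "finite J" "j \<notin> J"
  shows "signed_count k (insert j J) \<beta> t = (\<Sum>\<mu>\<in>removals k (\<beta> j) t. signed_count k J \<beta> \<mu>)"
proof -
  let ?R = "removals k (\<beta> j) t"
  \<comment> \<open>\<open>?f\<close> erases column \<open>j\<close> and records the row totals that
    remain; \<open>?g\<close> refills the column with the missing amounts
    \<open>t i - \<mu> i\<close>.\<close>
  let ?f = "\<lambda>(v,A). (\<lambda>i. if i < k then v i + (\<Sum>l\<in>J. A (i,l)) else 0,
      v, \<lambda>(i,l). if l = j then 0 else A (i,l)) ::
      (nat \<Rightarrow> nat) \<times> (nat \<Rightarrow> nat) \<times> (nat \<times> nat \<Rightarrow> nat)"
  let ?g = "\<lambda>(\<mu>,v,A). (v, \<lambda>(i,l). if l = j then (if i < k then t i - \<mu> i else 0) else A (i,l)) ::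
      (nat \<Rightarrow> nat) \<times> (nat \<times> nat \<Rightarrow> nat)"
  have "(\<Sum>\<mu>\<in>?R. signed_count k J \<beta> \<mu>)
      = (\<Sum>(\<mu>,v,A)\<in>Sigma ?R (shifted_matrices k J \<beta>). sign v)"
    unfolding signed_count_def
    by (subst sum.Sigma) (auto simp: finite_removals finite_shifted_matrices J case_prod_unfold)
  also have "\<dots> = signed_count k (insert j J) \<beta> t"
    unfolding signed_count_def
  proof (rule sum.reindex_bij_witness[of _ ?f ?g])
    fix p assume p: "p \<in> Sigma ?R (shifted_matrices k J \<beta>)"
    obtain \<mu> v A where pe: "p = (\<mu>,v,A)" by (cases p)
    have \<mu>: "\<And>i. i \<ge> k \<Longrightarrow> \<mu> i = 0" "\<And>i. i < k \<Longrightarrow> \<mu> i \<le> t i" "(\<Sum>i<k. \<mu> i) + \<beta> j = (\<Sum>i<k. t i)"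
      and v: "v permutes {..<k}" and A: "\<And>i l. A (i,l) \<noteq> 0 \<Longrightarrow> i < k \<and> l \<in> J"
        "\<And>l. l \<in> J \<Longrightarrow> (\<Sum>i<k. A (i,l)) = \<beta> l"
      and sm: "\<And>i. i < k \<Longrightarrow> v i + (\<Sum>l\<in>J. A (i,l)) = \<mu> i"
      using p by (auto simp: pe removals_def shifted_matrices_def column_matrices_def)
    have Aj: "A (i,j) = 0" for i using A(1)[of i j] J(2) by blast
    have neq: "l \<noteq> j" if "l \<in> J" for l using that J by auto
    have c: "(\<Sum>l\<in>J. if l = j then x l else y l) = (\<Sum>l\<in>J. y l)" for x y :: "nat \<Rightarrow> nat"
      using neq by (intro sum.cong) auto
    show "?f (?g p) = p"
      using \<mu>(1) sm Aj by (auto simp: pe fun_eq_iff c)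
    have cj: "(\<Sum>i<k. t i - \<mu> i) = \<beta> j"
      using \<mu>(2,3) by (subst sum_subtractf_nat) auto
    have cj': "(\<Sum>i<k. if i < k then t i - \<mu> i else 0) = \<beta> j"
      unfolding cj[symmetric] by (intro sum.cong) auto
    show "?g p \<in> shifted_matrices k (insert j J) \<beta> t"
    proof -
      have "v i + (t i - \<mu> i + (\<Sum>l\<in>J. A (i,l))) = t i" if "i < k" for i
        using sm[OF that] \<mu>(2)[OF that] by simp
      moreover have "(\<Sum>i<k. if l = j then (if i < k then t i - \<mu> i else 0) else A (i,l)) = \<beta> l"
        if "l \<in> insert j J" for l
      proof (cases "l = j")
        case True
        then show ?thesis using cj' by simp
      next
        case False
        then show ?thesis using that A(2)[of l] by simp
      qed
      ultimately show ?thesis using v A(1) J cj cj'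
        by (auto simp: pe shifted_matrices_def column_matrices_def c split: if_splits)
    qed
    show "(case ?g p of (v,A) \<Rightarrow> sign v) = (case p of (\<mu>,v,A) \<Rightarrow> sign v)" by (simp add: pe)
  next
    fix p assume p: "p \<in> shifted_matrices k (insert j J) \<beta> t"
    obtain v A where pe: "p = (v,A)" by (cases p)
    have v: "v permutes {..<k}" and A: "\<And>i l. A (i,l) \<noteq> 0 \<Longrightarrow> i < k \<and> l \<in> insert j J"
        "\<And>l. l \<in> insert j J \<Longrightarrow> (\<Sum>i<k. A (i,l)) = \<beta> l"
      and sm: "\<And>i. i < k \<Longrightarrow> v i + (A (i,j) + (\<Sum>l\<in>J. A (i,l))) = t i"
      using p J by (auto simp: pe shifted_matrices_def column_matrices_def)
    have neq: "l \<noteq> j" if "l \<in> J" for l using that J by auto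
    have c: "(\<Sum>l\<in>J. if l = j then x l else y l) = (\<Sum>l\<in>J. y l)" for x y :: "nat \<Rightarrow> nat"
      using neq by (intro sum.cong) auto
    have tm: "t i - (v i + (\<Sum>l\<in>J. A (i,l))) = A (i,j)" if "i < k" for i
      using sm[OF that] by simp
    have Ak: "A (i,l) = 0" if "\<not> i < k" for i l using A(1)[of i l] that by blast
    show "?g (?f p) = p" using tm Ak by (auto simp: pe fun_eq_iff)
    have "(\<Sum>i<k. v i + (\<Sum>l\<in>J. A (i,l))) + \<beta> j = (\<Sum>i<k. t i)"
    proof -
      have "(\<Sum>i<k. v i + (\<Sum>l\<in>J. A (i,l)) + A (i,j)) = (\<Sum>i<k. t i)"
      proof (rule sum.cong[OF refl])
        fix i assume "i \<in> {..<k}"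
        then show "v i + (\<Sum>l\<in>J. A (i,l)) + A (i,j) = t i" using sm[of i] by simp
      qed
      then show ?thesis using A(2)[of j] by (simp add: sum.distrib)
    qed
    moreover have "v i + (\<Sum>l\<in>J. A (i,l)) \<le> t i" if "i < k" for i using sm[OF that] by simp
    ultimately have "(\<lambda>i. if i < k then v i + (\<Sum>l\<in>J. A (i,l)) else 0) \<in> ?R"
      by (simp add: removals_def)
    moreover have "(v, \<lambda>(i,l). if l = j then 0 else A (i,l))
        \<in> shifted_matrices k J \<beta> (\<lambda>i. if i < k then v i + (\<Sum>l\<in>J. A (i,l)) else 0)"
    proof -
      have "i < k \<and> l \<in> J" if "(if l = j then 0 else A (i,l)) \<noteq> 0" for i l
        using that A(1)[of i l] by (auto split: if_splits)
      moreover have "(\<Sum>i<k. if l = j then 0 else A (i,l)) = \<beta> l" if "l \<in> J" for l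
        using A(2)[of l] neq[OF that] that by simp
      ultimately show ?thesis
        using v by (auto simp: shifted_matrices_def column_matrices_def c)
    qed
    ultimately show "?f p \<in> Sigma ?R (shifted_matrices k J \<beta>)" by (simp add: pe)
  qed
  finally show ?thesis by simp
qed

lemma signed_count_empty:
  assumes "\<And>i. i < k \<Longrightarrow> t i = i"
  shows "signed_count k {} \<beta> t = 1"
proof -
  have "shifted_matrices k {} \<beta> t = {(id, \<lambda>_. 0)}"
  proof (intro equalityI subsetI)
    fix p assume p: "p \<in> shifted_matrices k {} \<beta> t"
    obtain v A where pe: "p = (v,A)" by (cases p)
    have v: "v permutes {..<k}" and vi: "\<And>i. i < k \<Longrightarrow> v i = i" and A: "\<And>i j. A (i,j) = 0"
      using p assms by (auto simp: pe shifted_matrices_def column_matrices_def)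
    have "v i = i" for i using vi v by (cases "i < k") (auto simp: permutes_def)
    then show "p \<in> {(id, \<lambda>_. 0)}" using A by (auto simp: pe fun_eq_iff)
  qed (use assms in \<open>auto simp: shifted_matrices_def column_matrices_def permutes_id\<close>)
  then show ?thesis by (simp add: signed_count_def)
qed

text \<open>Exchanging the positions \<open>i - 1\<close> and \<open>i\<close>, for the largest \<open>i\<close> with \<open>\<mu> i \<le> t (i - 1)\<close>, is a
  sign-reversing involution on the discarded terms.\<close>

lemma signed_count_removals_cancel:
  assumes mono: "\<And>i. 1 \<le> i \<Longrightarrow> i < k \<Longrightarrow> t (i - 1) \<le> t i"
  shows "(\<Sum>\<mu>\<in>removals k r t. signed_count k J \<beta> \<mu>)
    = (\<Sum>\<mu>\<in>{\<mu>\<in>removals k r t. \<forall>i. 1 \<le> i \<and> i < k \<longrightarrow> t (i - 1) < \<mu> i}. signed_count k J \<beta> \<mu>)"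
proof -
  let ?R = "removals k r t"
  define P where "P \<mu> = {i. 1 \<le> i \<and> i < k \<and> \<mu> i \<le> t (i - 1)}" for \<mu> :: "nat \<Rightarrow> nat"
  define Bad where "Bad = {\<mu>\<in>?R. P \<mu> \<noteq> {}}"
  define f where "f \<mu> = \<mu> \<circ> transpose (Max (P \<mu>) - 1) (Max (P \<mu>))" for \<mu> :: "nat \<Rightarrow> nat"
  have finP: "finite (P \<mu>)" for \<mu> by (rule finite_subset[of _ "{..<k}"]) (auto simp: P_def)
  have step: "f \<mu> \<in> Bad \<and> f (f \<mu>) = \<mu> \<and> signed_count k J \<beta> (f \<mu>) = - signed_count k J \<beta> \<mu>"
    if \<mu>: "\<mu> \<in> Bad" for \<mu>
  proof -
    define i where "i = Max (P \<mu>)"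
    have "i \<in> P \<mu>" unfolding i_def using \<mu> by (intro Max_in finP) (simp add: Bad_def)
    then have i: "1 \<le> i" "i < k" "\<mu> i \<le> t (i - 1)" by (auto simp: P_def)
    have ne: "i - 1 \<noteq> i" using i by simp
    let ?\<tau> = "transpose (i - 1) i"
    have f: "f \<mu> = \<mu> \<circ> ?\<tau>" by (simp add: f_def i_def)
    have R: "\<And>l. l \<ge> k \<Longrightarrow> \<mu> l = 0" "\<And>l. l < k \<Longrightarrow> \<mu> l \<le> t l" "(\<Sum>i<k. \<mu> i) + r = (\<Sum>i<k. t i)"
      using \<mu> by (auto simp: Bad_def removals_def)
    have \<tau>: "?\<tau> permutes {..<k}" using i by (intro permutes_swap_id) auto
    \<comment> \<open>The exchange stays below \<open>t\<close>: at \<open>i - 1\<close> by the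
      choice of \<open>i\<close>, and at \<open>i\<close> because
      \<open>\<mu> (i - 1) \<le> t (i - 1) \<le> t i\<close>, which is where monotonicity
      enters.\<close>
    have "f \<mu> l \<le> t l" if "l < k" for l
    proof -
      consider "l = i - 1" | "l = i" | "l \<noteq> i - 1" "l \<noteq> i" by blast
      then show ?thesis
      proof cases
        case 1 then show ?thesis using i by (simp add: f)
      next
        case 2 then show ?thesis using i order_trans[OF R(2)[of "i - 1"] mono[of i]] by (simp add: f)
      next
        case 3 then show ?thesis using R(2)[OF that] by (simp add: f transpose_def)
      qed
    qed
    moreover have "f \<mu> l = 0" if "l \<ge> k" for l using that i R(1)[OF that] by (auto simp: f transpose_def)
    moreover have "(\<Sum>l<k. f \<mu> l) = (\<Sum>l<k. \<mu> l)" unfolding f by (rule sum.permute[OF \<tau>, symmetric])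
    ultimately have fR: "f \<mu> \<in> ?R" using R(3) by (simp add: removals_def)
    \<comment> \<open>The same \<open>i\<close> is selected again: it still violates the strict
      inequality since \<open>\<mu> (i - 1) \<le> t (i - 1)\<close>, and the entries beyond
      \<open>i\<close> have not changed. Hence \<open>f\<close> is an involution.\<close>
    have iP: "i \<in> P (f \<mu>)" using i R(2)[of "i - 1"] by (simp add: P_def f)
    have "l \<le> i" if l: "l \<in> P (f \<mu>)" for l
    proof (rule ccontr)
      assume "\<not> l \<le> i"
      then have "l \<in> P \<mu>" using l i by (auto simp: P_def f transpose_def split: if_splits)
      then show False using Max_ge[OF finP, of l \<mu>] \<open>\<not> l \<le> i\<close> by (simp add: i_def)
    qed
    then have mx: "Max (P (f \<mu>)) = i" using iP by (intro Max_eqI finP) auto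
    have "f (f \<mu>) = f \<mu> \<circ> ?\<tau>" unfolding f_def[of "f \<mu>"] mx ..
    also have "\<dots> = \<mu>" by (simp add: f o_assoc[symmetric])
    finally have "f (f \<mu>) = \<mu>" .
    moreover have "signed_count k J \<beta> (f \<mu>) = - signed_count k J \<beta> \<mu>"
      unfolding f using i ne by (intro signed_count_transpose) auto
    ultimately show ?thesis using fR iP by (auto simp: Bad_def)
  qed
  \<comment> \<open>Fixed points of \<open>f\<close> need no separate treatment: the sign reversal
    already makes their count zero.\<close>
  have "(\<Sum>\<mu>\<in>Bad. signed_count k J \<beta> \<mu>) = (\<Sum>\<mu>\<in>Bad. - signed_count k J \<beta> \<mu>)"
    by (rule sum.reindex_bij_witness[of _ f f]) (use step in auto)
  then have "(\<Sum>\<mu>\<in>Bad. signed_count k J \<beta> \<mu>) = 0" by (simp add: sum_negf)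
  moreover have "(\<Sum>\<mu>\<in>?R. signed_count k J \<beta> \<mu>)
      = (\<Sum>\<mu>\<in>?R - Bad. signed_count k J \<beta> \<mu>) + (\<Sum>\<mu>\<in>Bad. signed_count k J \<beta> \<mu>)"
    by (rule sum.subset_diff) (auto simp: Bad_def finite_removals)
  moreover have "?R - Bad = {\<mu>\<in>?R. \<forall>i. 1 \<le> i \<and> i < k \<longrightarrow> t (i - 1) < \<mu> i}"
    by (auto simp: Bad_def P_def not_le)
  ultimately show ?thesis by simp
qed

text \<open>The exponents \<open>\<lambda> + \<delta>\<close> of the rectangle with \<open>k\<close> columns and \<open>k - m\<close> rows, in increasing order.\<close>

definition rectangle_exponents :: "nat \<Rightarrow> nat \<Rightarrow> nat \<Rightarrow> nat"
  where "rectangle_exponents k m i = (if i < m then i else k + i)"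

text \<open>Where \<open>t (i - 1) + 1 = t i\<close>, the bounds
  \<open>t (i - 1) < \<mu> i \<le> t i\<close> leave no freedom, and below the gap the entry at 0 is
  already 0. Only the entry at \<open>m\<close> can move, and it must absorb the whole amount
  \<open>k\<close>. In shapes: a horizontal strip of size \<open>k\<close> in a rectangle with
  \<open>k\<close> columns is a full row.\<close>

lemma removals_row:
  assumes m: "m < k"
  shows "{\<mu>\<in>removals k k (rectangle_exponents k m).
      \<forall>i. 1 \<le> i \<and> i < k \<longrightarrow> rectangle_exponents k m (i - 1) < \<mu> i}
    = {\<lambda>i. if i < k then rectangle_exponents k (Suc m) i else 0}" (is "?L = {?\<nu>}")
proof -
  let ?t = "rectangle_exponents k m"
  have split: "(\<Sum>i<k. f i) = f m + (\<Sum>i\<in>{..<k} - {m}. f i)" for f :: "nat \<Rightarrow> nat"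
    using m by (intro sum.remove) auto
  have "\<mu> = ?\<nu>" if \<mu>: "\<mu> \<in> ?L" for \<mu>
  proof -
    have R: "\<And>l. l \<ge> k \<Longrightarrow> \<mu> l = 0" "\<And>l. l < k \<Longrightarrow> \<mu> l \<le> ?t l" "(\<Sum>i<k. \<mu> i) + k = (\<Sum>i<k. ?t i)"
      and gt: "\<And>i. 1 \<le> i \<Longrightarrow> i < k \<Longrightarrow> ?t (i - 1) < \<mu> i"
      using \<mu> by (auto simp: removals_def)
    have eq: "\<mu> i = ?t i" if "i < k" "i \<noteq> m" for i
    proof (cases "i = 0")
      case True
      then show ?thesis using R(2)[OF that(1)] that by (simp add: rectangle_exponents_def)
    next
      case False
      then show ?thesis using gt[of i] R(2)[OF that(1)] that
        by (auto simp: rectangle_exponents_def split: if_splits)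
    qed
    have "(\<Sum>i\<in>{..<k} - {m}. \<mu> i) = (\<Sum>i\<in>{..<k} - {m}. ?t i)" using eq by (intro sum.cong) auto
    then have "\<mu> m + k = ?t m" using R(3) split[of \<mu>] split[of ?t] by simp
    then have "\<mu> m = m" by (simp add: rectangle_exponents_def)
    then have "\<mu> i = ?\<nu> i" for i
      using eq[of i] R(1)[of i] m by (cases "i = m") (auto simp: rectangle_exponents_def not_less)
    then show ?thesis by (rule ext)
  qed
  moreover have "?\<nu> \<in> ?L"
  proof -
    have "(\<Sum>i\<in>{..<k} - {m}. ?\<nu> i) = (\<Sum>i\<in>{..<k} - {m}. ?t i)"
      by (intro sum.cong) (auto simp: rectangle_exponents_def)
    then have "(\<Sum>i<k. ?\<nu> i) + k = (\<Sum>i<k. ?t i)"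
      using split[of ?\<nu>] split[of ?t] m by (simp add: rectangle_exponents_def)
    then have "?\<nu> \<in> removals k k ?t" by (auto simp: removals_def rectangle_exponents_def)
    moreover have "?t (i - 1) < ?\<nu> i" if "1 \<le> i" "i < k" for i
      using that by (auto simp: rectangle_exponents_def)
    ultimately show ?thesis by simp
  qed
  ultimately show ?thesis by blast
qed

lemma rectangle_exponents_mono:
  "rectangle_exponents k m (i - 1) \<le> rectangle_exponents k m i"
  by (auto simp: rectangle_exponents_def)

lemma signed_count_insert_rectangle:
  assumes "finite J" "j \<notin> J"
  shows "signed_count k (insert j J) \<beta> (rectangle_exponents k m)
    = (\<Sum>\<mu>\<in>{\<mu>\<in>removals k (\<beta> j) (rectangle_exponents k m).
        \<forall>i. 1 \<le> i \<and> i < k \<longrightarrow> rectangle_exponents k m (i - 1) < \<mu> i}. signed_count k J \<beta> \<mu>)"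
  unfolding signed_count_insert[OF assms]
  by (rule signed_count_removals_cancel) (rule rectangle_exponents_mono)

text \<open>Each column of the matrix removes one row of the rectangle, and \<open>m\<close> counts
  the rows already gone. When no columns remain, \<open>m = k\<close> and the exponents are those of
  the diagonal term of the Vandermonde determinant.\<close>

lemma signed_count_rectangle:
  assumes "finite J" "card J + m = k" "\<And>j. j \<in> J \<Longrightarrow> \<beta> j = k"
  shows "signed_count k J \<beta> (rectangle_exponents k m) = 1"
  using assms
proof (induction J arbitrary: m rule: finite_induct)
  case empty
  then show ?case by (intro signed_count_empty) (simp add: rectangle_exponents_def)
next
  case (insert j J)
  then have m: "m < k" and \<beta>: "\<beta> j = k" by auto
  have "signed_count k (insert j J) \<beta> (rectangle_exponents k m)
      = signed_count k J \<beta> (\<lambda>i. if i < k then rectangle_exponents k (Suc m) i else 0)"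
    unfolding signed_count_insert_rectangle[OF insert.hyps] \<beta> removals_row[OF m] by simp
  also have "\<dots> = signed_count k J \<beta> (rectangle_exponents k (Suc m))"
    by (rule signed_count_cong) simp
  also have "\<dots> = 1" using insert by (intro insert.IH) auto
  finally show ?case .
qed

text \<open>The columns may be expanded in any order, so the wide one is taken first. For the full
  square every entry except the one at 0 is rigid, and that one can drop by at most
  \<open>k\<close>.\<close>

lemma signed_count_square_wide_column:
  assumes J: "finite J" "j \<in> J" and \<beta>: "\<beta> j > k"
  shows "signed_count k J \<beta> (rectangle_exponents k 0) = 0"
proof -
  let ?t = "rectangle_exponents k 0"
  have empty: "{\<mu>\<in>removals k (\<beta> j) ?t. \<forall>i. 1 \<le> i \<and> i < k \<longrightarrow> ?t (i - 1) < \<mu> i} = {}"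
  proof (intro equals0I)
    fix \<mu> assume \<mu>: "\<mu> \<in> {\<mu>\<in>removals k (\<beta> j) ?t. \<forall>i. 1 \<le> i \<and> i < k \<longrightarrow> ?t (i - 1) < \<mu> i}"
    then have R: "(\<Sum>i<k. \<mu> i) + \<beta> j = (\<Sum>i<k. ?t i)"
      and gt: "\<And>i. 1 \<le> i \<Longrightarrow> i < k \<Longrightarrow> ?t (i - 1) < \<mu> i"
      by (auto simp: removals_def)
    \<comment> \<open>Here \<open>?t i = k + i\<close>, so \<open>?t (i - 1) < \<mu> i\<close>
      already gives \<open>?t i \<le> \<mu> i\<close> for \<open>i \<ge> 1\<close>; at 0 the slack
      is \<open>?t 0 = k\<close>.\<close>
    have ge: "?t i \<le> \<mu> i + (if i = 0 then k else 0)" if "i < k" for i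
      using gt[of i] that by (auto simp: rectangle_exponents_def)
    have "(\<Sum>i<k. ?t i) \<le> (\<Sum>i<k. \<mu> i + (if i = 0 then k else 0))"
      using ge by (intro sum_mono) auto
    also have "\<dots> \<le> (\<Sum>i<k. \<mu> i) + k" by (simp add: sum.distrib sum.delta)
    finally show False using R \<beta> by simp
  qed
  have J': "finite (J - {j})" "j \<notin> J - {j}" using J by auto
  have "signed_count k (insert j (J - {j})) \<beta> ?t = 0"
    unfolding signed_count_insert_rectangle[OF J'] empty by simp
  then show ?thesis using J by (simp add: insert_absorb)
qed

text \<open>If the \<open>k\<close> column sums have average \<open>k\<close> but are not all equal
  to \<open>k\<close>, one of them exceeds \<open>k\<close>. This is the only information about
  \<open>\<beta>\<close> that the vanishing requires.\<close>

lemma signed_count_square: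
  assumes "(\<Sum>j<k. \<beta> j) = k * k"
  shows "signed_count k {..<k} \<beta> (\<lambda>i. k + i) = (if \<forall>j<k. \<beta> j = k then 1 else 0)"
proof -
  have t: "(\<lambda>i. k + i) = rectangle_exponents k 0" by (simp add: rectangle_exponents_def fun_eq_iff)
  show ?thesis
  proof (cases "\<forall>j<k. \<beta> j = k")
    case True
    then show ?thesis unfolding t by (subst signed_count_rectangle) auto
  next
    case False
    have "\<exists>j<k. \<beta> j > k"
    proof (rule ccontr)
      assume "\<not> ?thesis"
      then have le: "\<beta> j \<le> k" if "j < k" for j using that by (meson not_less)
      obtain l where l: "l < k" "\<beta> l \<noteq> k" using False by blast
      have "(\<Sum>j<k. \<beta> j) < (\<Sum>j<k. k)"
        using le l by (intro sum_strict_mono_ex1) (auto simp: le_less)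
      then show False using assms by simp
    qed
    then show ?thesis unfolding t using False signed_count_square_wide_column[of "{..<k}"] by auto
  qed
qed

section \<open>Words and Frobenius' formula for the square\<close>

definition content :: "nat \<Rightarrow> (nat \<Rightarrow> 'c) \<Rightarrow> 'c \<Rightarrow> nat"
  where "content n w c = card {x\<in>{1..n}. w x = c}"

text \<open>The words form the coset space of a Young subgroup. Extensionality fixes the values off
  \<open>{1..n}\<close>, and the letter type is left open because words over pairs of numbers occur
  as well.\<close>

definition words :: "nat \<Rightarrow> ('c \<Rightarrow> nat) \<Rightarrow> (nat \<Rightarrow> 'c) set"
  where "words n \<alpha> = {w \<in> extensional {1..n}. content n w = \<alpha>}"

definition fixed_words :: "nat \<Rightarrow> ('c \<Rightarrow> nat) \<Rightarrow> (nat \<Rightarrow> nat) \<Rightarrow> (nat \<Rightarrow> 'c) set"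
  where "fixed_words n \<alpha> g = {w \<in> words n \<alpha>. w \<circ> g = w}"

text \<open>The inverse turns composition on the right into a left action; the restriction puts the
  map into \<open>BijGroup\<close>.\<close>

definition word_action :: "nat \<Rightarrow> ('c \<Rightarrow> nat) \<Rightarrow> (nat \<Rightarrow> nat) \<Rightarrow> (nat \<Rightarrow> 'c) \<Rightarrow> nat \<Rightarrow> 'c"
  where "word_action n \<alpha> g = (\<lambda>w\<in>words n \<alpha>. w \<circ> inv' g)"

lemma content_nonzero:
  assumes "w \<in> words n \<alpha>" "x \<in> {1..n}"
  shows "\<alpha> (w x) \<noteq> 0"
proof -
  have "x \<in> {y\<in>{1..n}. w y = w x}" using assms by simp
  then have "content n w (w x) \<noteq> 0" by (auto simp: content_def)
  then show ?thesis using assms by (simp add: words_def)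
qed

lemma finite_words: "finite (words n \<alpha>)"
proof (cases "words n \<alpha> = {}")
  case False
  then obtain u where u: "u \<in> words n \<alpha>" by blast
  \<comment> \<open>The letter type may be infinite. One word \<open>u\<close> of content
    \<open>\<alpha>\<close> already uses every letter that any other such word can use.\<close>
  have sub: "{c. \<alpha> c \<noteq> 0} \<subseteq> u ` {1..n}"
  proof
    fix c assume "c \<in> {c. \<alpha> c \<noteq> 0}"
    then have "content n u c \<noteq> 0" using u by (simp add: words_def)
    then have "{x\<in>{1..n}. u x = c} \<noteq> {}" unfolding content_def by (metis card.empty)
    then show "c \<in> u ` {1..n}" by auto
  qed
  have "words n \<alpha> \<subseteq> {1..n} \<rightarrow>\<^sub>E {c. \<alpha> c \<noteq> 0}"
  proof
    fix w assume w: "w \<in> words n \<alpha>"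
    then have "w \<in> extensional {1..n}" by (simp add: words_def)
    then show "w \<in> {1..n} \<rightarrow>\<^sub>E {c. \<alpha> c \<noteq> 0}"
      using content_nonzero[OF w] by (simp add: PiE_def Pi_def)
  qed
  moreover have "finite ({1..n} \<rightarrow>\<^sub>E {c. \<alpha> c \<noteq> 0})"
    by (intro finite_PiE finite_subset[OF sub]) auto
  ultimately show ?thesis by (rule finite_subset)
qed simp

lemma content_comp_permutes:
  assumes "p permutes {1..n}"
  shows "content n (w \<circ> p) = content n w"
proof
  fix c
  have "p ` {x\<in>{1..n}. (w \<circ> p) x = c} = {x\<in>{1..n}. w x = c}"
  proof (intro equalityI subsetI)
    fix y assume "y \<in> {x\<in>{1..n}. w x = c}"
    then have "y = p (inv' p y)" "inv' p y \<in> {1..n}" "w y = c"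
      using permutes_inverses(1)[OF assms] permutes_in_image[OF permutes_inv[OF assms]] by auto
    then show "y \<in> p ` {x\<in>{1..n}. (w \<circ> p) x = c}" by (intro image_eqI[of _ _ "inv' p y"]) auto
  next
    fix y assume "y \<in> p ` {x\<in>{1..n}. (w \<circ> p) x = c}"
    then show "y \<in> {x\<in>{1..n}. w x = c}" using permutes_in_image[OF assms] by auto
  qed
  moreover have "inj_on p {x\<in>{1..n}. (w \<circ> p) x = c}"
    using permutes_inj[OF assms] by (rule inj_on_subset) simp
  ultimately show "content n (w \<circ> p) c = content n w c"
    unfolding content_def using card_image by fastforce
qed

lemma words_comp_permutes:
  assumes "p permutes {1..n}" "w \<in> words n \<alpha>"
  shows "w \<circ> p \<in> words n \<alpha>"
  using assms content_comp_permutes[OF assms(1), of w] permutes_not_in[OF assms(1)]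
  by (auto simp: words_def extensional_def)

section \<open>The symmetric group acting on words, and Burnside's lemma\<close>

lemma word_action: "group_action (sym_group n) (words n \<alpha>) (word_action n \<alpha>)"
proof -
  let ?E = "words n \<alpha>" and ?\<phi> = "word_action n \<alpha>"
  have Bij: "?\<phi> g \<in> Bij ?E" if g: "g permutes {1..n}" for g
  proof -
    have "bij_betw (\<lambda>w. w \<circ> inv' g) ?E ?E"
    proof (rule bij_betw_byWitness[where f' = "\<lambda>w. w \<circ> g"])
      show "\<forall>w\<in>?E. (w \<circ> inv' g) \<circ> g = w" "\<forall>w\<in>?E. (w \<circ> g) \<circ> inv' g = w"
        using permutes_inv_o[OF g] by (simp_all add: o_assoc[symmetric])
      show "(\<lambda>w. w \<circ> inv' g) ` ?E \<subseteq> ?E" "(\<lambda>w. w \<circ> g) ` ?E \<subseteq> ?E"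
        using words_comp_permutes[OF g] words_comp_permutes[OF permutes_inv[OF g]] by auto
    qed
    moreover have "bij_betw (?\<phi> g) ?E ?E \<longleftrightarrow> bij_betw (\<lambda>w. w \<circ> inv' g) ?E ?E"
      by (rule bij_betw_cong) (simp add: word_action_def)
    ultimately show ?thesis by (simp add: Bij_def word_action_def)
  qed
  have mult: "?\<phi> (g \<circ> h) = compose ?E (?\<phi> g) (?\<phi> h)" if g: "g permutes {1..n}" and h: "h permutes {1..n}" for g h
  proof -
    have "inv' (g \<circ> h) = inv' h \<circ> inv' g" using g h by (intro o_inv_distrib permutes_bij)
    then show ?thesis
      using words_comp_permutes[OF permutes_inv[OF h]]
      by (auto simp: fun_eq_iff word_action_def compose_def o_assoc)
  qed
  have "?\<phi> \<in> hom (sym_group n) (BijGroup ?E)"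
  proof (rule homI)
    fix g h assume gh: "g \<in> carrier (sym_group n)" "h \<in> carrier (sym_group n)"
    then show "?\<phi> g \<in> carrier (BijGroup ?E)" using Bij by (simp add: BijGroup_def sym_group_carrier)
    show "?\<phi> (g \<otimes>\<^bsub>sym_group n\<^esub> h) = ?\<phi> g \<otimes>\<^bsub>BijGroup ?E\<^esub> ?\<phi> h"
      using gh Bij mult by (simp add: BijGroup_def sym_group_carrier sym_group_mult)
  qed
  then show ?thesis
    unfolding group_action_def group_hom_def group_hom_axioms_def
    using sym_group_is_group group_BijGroup by blast
qed

lemma comp_inv_permutes_iff:
  assumes "g permutes S"
  shows "w \<circ> inv' g = w \<longleftrightarrow> w \<circ> g = w"
proof
  assume "w \<circ> inv' g = w"
  then have "w \<circ> g = (w \<circ> inv' g) \<circ> g" by simp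
  then show "w \<circ> g = w" using permutes_inv_o(2)[OF assms] by (simp add: o_assoc[symmetric])
next
  assume "w \<circ> g = w"
  then have "w \<circ> inv' g = (w \<circ> g) \<circ> inv' g" by simp
  then show "w \<circ> inv' g = w" using permutes_inv_o(1)[OF assms] by (simp add: o_assoc[symmetric])
qed

lemma invariants_word_action:
  assumes "g permutes {1..n}"
  shows "invariants (words n \<alpha>) (word_action n \<alpha>) g = fixed_words n \<alpha> g"
  using comp_inv_permutes_iff[OF assms]
  by (auto simp: invariants_def fixed_words_def word_action_def)

lemma fixed_words_inv:
  assumes "g permutes {1..n}"
  shows "fixed_words n \<alpha> (inv' g) = fixed_words n \<alpha> g"
  unfolding fixed_words_def comp_inv_permutes_iff[OF assms] ..

lemma words_same_content:
  assumes u: "u \<in> words n \<alpha>" and w: "w \<in> words n \<alpha>"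
  obtains p where "p permutes {1..n}" "u = w \<circ> p"
proof -
  have "image_mset u (mset_set {1..n}) = image_mset w (mset_set {1..n})"
  proof (rule multiset_eqI)
    fix c
    have "content n u c = content n w c" using u w by (simp add: words_def)
    then show "count (image_mset u (mset_set {1..n})) c = count (image_mset w (mset_set {1..n})) c"
      by (simp add: count_image_mset_eq_card_vimage content_def)
  qed
  then obtain p where p: "p permutes {1..n}" "\<forall>x\<in>{1..n}. u x = w (p x)"
    using image_mset_eq_implies_permutes[of "{1..n}" u w] by blast
  have "u x = (w \<circ> p) x" for x
  proof (cases "x \<in> {1..n}")
    case False
    then show ?thesis using u w permutes_not_in[OF p(1)] by (simp add: words_def extensional_def)
  qed (use p in simp)
  then show thesis using that[OF p(1)] by blast
qed

text \<open>Words of equal content are rearrangements of each other, so the action has a single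
  orbit and Burnside's lemma gives the group order.\<close>

lemma sum_card_fixed_words:
  assumes "words n \<alpha> \<noteq> {}"
  shows "(\<Sum>g\<in>carrier (sym_group n). card (fixed_words n \<alpha> g)) = fact n"
proof -
  let ?E = "words n \<alpha>" and ?\<phi> = "word_action n \<alpha>"
  interpret group_action "sym_group n" ?E ?\<phi> by (rule word_action)
  have fin: "finite (carrier (sym_group n))"
    using finite_permutations[of "{1..n}"] by (simp add: sym_group_def)
  have "orbit (sym_group n) ?\<phi> w = ?E" if w: "w \<in> ?E" for w
  proof (intro equalityI subsetI)
    fix u assume "u \<in> ?E"
    then obtain p where p: "p permutes {1..n}" "u = w \<circ> p" using words_same_content w by blast
    then have "u = ?\<phi> (inv' p) w" using w by (simp add: word_action_def inv_inv_eq permutes_bij)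
    moreover have "inv' p \<in> carrier (sym_group n)" using p permutes_inv by (simp add: sym_group_carrier)
    ultimately show "u \<in> orbit (sym_group n) ?\<phi> w" unfolding orbit_def by blast
  next
    fix u assume "u \<in> orbit (sym_group n) ?\<phi> w"
    then show "u \<in> ?E" using element_image[OF _ w] unfolding orbit_def by blast
  qed
  then have "orbits (sym_group n) ?E ?\<phi> = {?E}" using assms unfolding orbits_def by auto
  then have "(\<Sum>g\<in>carrier (sym_group n). card (invariants ?E ?\<phi> g)) = fact n"
    using burnside[OF fin finite_words] by (simp add: Coset.order_def sym_group_card_carrier)
  then show ?thesis by (simp add: invariants_word_action sym_group_carrier)
qed

lemma words_nonempty:
  assumes C: "finite C" and \<alpha>: "\<And>c. c \<notin> C \<Longrightarrow> \<alpha> c = 0" and n: "sum \<alpha> C = n"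
  shows "words n \<alpha> \<noteq> {}"
proof -
  let ?M = "\<Sum>c\<in>C. replicate_mset (\<alpha> c) c"
  obtain xs where xs: "mset xs = ?M" using ex_mset by blast
  have "length xs = n" using arg_cong[OF xs, of size] n by simp
  define w where "w = (\<lambda>x\<in>{1..n}. xs ! (x - 1))"
  have "content n w c = \<alpha> c" for c
  proof -
    have "content n w c = card {i. i < length xs \<and> c = xs ! i}"
      unfolding content_def
      by (rule bij_betw_same_card[of "\<lambda>x. x - 1"], rule bij_betw_byWitness[where f' = Suc])
        (auto simp: w_def \<open>length xs = n\<close>)
    also have "\<dots> = count (mset xs) c"
      by (simp add: count_mset count_list_eq_length_filter length_filter_conv_card)
    also have "\<dots> = \<alpha> c" using C \<alpha>[of c] by (simp add: xs count_sum if_distrib cong: if_cong)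
    finally show ?thesis .
  qed
  then have "w \<in> words n \<alpha>" by (auto simp: words_def w_def)
  then show ?thesis by blast
qed

section \<open>Products of permutation characters and matrices with given margins\<close>

definition margin_matrices :: "nat \<Rightarrow> (nat \<Rightarrow> nat) \<Rightarrow> (nat \<Rightarrow> nat) \<Rightarrow> (nat \<times> nat \<Rightarrow> nat) set"
  where "margin_matrices k \<alpha> \<beta> =
    {A \<in> column_matrices k {..<k} \<beta>. \<forall>i<k. (\<Sum>j<k. A (i,j)) = \<alpha> i}"

lemma content_fst:
  fixes w :: "nat \<Rightarrow> 'c \<times> nat"
  assumes "\<And>x. x \<in> {1..n} \<Longrightarrow> snd (w x) < k"
  shows "content n (\<lambda>x\<in>{1..n}. fst (w x)) i = (\<Sum>j<k. content n w (i,j))"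
proof -
  have "{x\<in>{1..n}. (\<lambda>x\<in>{1..n}. fst (w x)) x = i} = (\<Union>j<k. {x\<in>{1..n}. w x = (i,j)})"
    using assms by (auto simp: prod_eq_iff)
  then have "content n (\<lambda>x\<in>{1..n}. fst (w x)) i = card (\<Union>j<k. {x\<in>{1..n}. w x = (i,j)})"
    unfolding content_def by (rule arg_cong)
  also have "\<dots> = (\<Sum>j<k. content n w (i,j))"
    unfolding content_def by (rule card_UN_disjoint) auto
  finally show ?thesis .
qed

lemma content_snd:
  fixes w :: "nat \<Rightarrow> nat \<times> 'c"
  assumes "\<And>x. x \<in> {1..n} \<Longrightarrow> fst (w x) < k"
  shows "content n (\<lambda>x\<in>{1..n}. snd (w x)) j = (\<Sum>i<k. content n w (i,j))"
proof -
  have "{x\<in>{1..n}. (\<lambda>x\<in>{1..n}. snd (w x)) x = j} = (\<Union>i<k. {x\<in>{1..n}. w x = (i,j)})"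
    using assms by (auto simp: prod_eq_iff)
  then have "content n (\<lambda>x\<in>{1..n}. snd (w x)) j = card (\<Union>i<k. {x\<in>{1..n}. w x = (i,j)})"
    unfolding content_def by (rule arg_cong)
  also have "\<dots> = (\<Sum>i<k. content n w (i,j))"
    unfolding content_def by (rule card_UN_disjoint) auto
  finally show ?thesis .
qed

text \<open>A pair of words is one word over pairs of letters. Its content is a matrix whose row and
  column sums are the two given contents, and it is fixed by \<open>g\<close> exactly when both
  components are.\<close>

lemma card_fixed_words_product:
  assumes g: "g permutes {1..n}"
    and \<alpha>: "\<And>i. i \<ge> k \<Longrightarrow> \<alpha> i = 0" and \<beta>: "\<And>i. i \<ge> k \<Longrightarrow> \<beta> i = 0"
  shows "card (fixed_words n \<alpha> g) * card (fixed_words n \<beta> g)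
    = (\<Sum>A\<in>margin_matrices k \<alpha> \<beta>. card (fixed_words n A g))"
proof -
  let ?M = "margin_matrices k \<alpha> \<beta>"
  have gin: "g x \<in> {1..n} \<longleftrightarrow> x \<in> {1..n}" for x using permutes_in_image[OF g] .
  define join where "join = (\<lambda>(u,v). \<lambda>x\<in>{1..n}. (u x :: nat, v x :: nat))"
  define split where "split w = (\<lambda>x\<in>{1..n}. fst (w x) :: nat, \<lambda>x\<in>{1..n}. snd (w x) :: nat)" for w
  have fixed: "w \<circ> g = w \<longleftrightarrow> (\<forall>x\<in>{1..n}. w (g x) = w x)" for w :: "nat \<Rightarrow> 'c"
    using permutes_not_in[OF g] by (auto simp: fun_eq_iff)
  have small: "fst (w x) < k \<and> snd (w x) < k" if "w \<in> words n A" "A \<in> ?M" "x \<in> {1..n}" for w A x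
  proof -
    have "A (fst (w x), snd (w x)) \<noteq> 0" using content_nonzero[OF that(1,3)] by simp
    then show ?thesis using that(2) by (cases "w x") (auto simp: margin_matrices_def column_matrices_def)
  qed
  have "bij_betw join (fixed_words n \<alpha> g \<times> fixed_words n \<beta> g) (\<Union>A\<in>?M. fixed_words n A g)"
  proof (rule bij_betw_byWitness[where f' = split])
    show "\<forall>p\<in>fixed_words n \<alpha> g \<times> fixed_words n \<beta> g. split (join p) = p"
      by (auto simp: split_def join_def fixed_words_def words_def extensional_def fun_eq_iff)
    show "\<forall>w\<in>(\<Union>A\<in>?M. fixed_words n A g). join (split w) = w"
      by (auto simp: split_def join_def fixed_words_def words_def extensional_def fun_eq_iff)
    show "join ` (fixed_words n \<alpha> g \<times> fixed_words n \<beta> g) \<subseteq> (\<Union>A\<in>?M. fixed_words n A g)"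
    proof
      fix w assume "w \<in> join ` (fixed_words n \<alpha> g \<times> fixed_words n \<beta> g)"
      then obtain u v where u: "u \<in> fixed_words n \<alpha> g" and v: "v \<in> fixed_words n \<beta> g" and w: "w = join (u,v)"
        by auto
      have uw: "u \<in> words n \<alpha>" and vw: "v \<in> words n \<beta>" using u v by (auto simp: fixed_words_def)
      have uk: "u x < k" and vk: "v x < k" if "x \<in> {1..n}" for x
        using content_nonzero[OF uw that] content_nonzero[OF vw that] \<alpha> \<beta> by (meson not_less)+
      have ue: "u = (\<lambda>x\<in>{1..n}. fst (w x))" and ve: "v = (\<lambda>x\<in>{1..n}. snd (w x))"
        using uw vw by (auto simp: w join_def words_def extensional_def fun_eq_iff)
      have "content n w \<in> ?M"
        unfolding margin_matrices_def column_matrices_def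
      proof (intro CollectI conjI allI impI ballI)
        fix i j
        assume "content n w (i,j) \<noteq> 0"
        then have "{x\<in>{1..n}. w x = (i,j)} \<noteq> {}" unfolding content_def by (metis card.empty)
        then obtain x where "x \<in> {1..n}" "w x = (i,j)" by blast
        then show "i < k" "j \<in> {..<k}" using uk[of x] vk[of x] by (auto simp: w join_def)
      next
        fix j assume "j \<in> {..<k}"
        have "(\<Sum>i<k. content n w (i,j)) = content n v j"
          unfolding ve by (rule content_snd[symmetric]) (simp add: w join_def uk)
        then show "(\<Sum>i<k. content n w (i,j)) = \<beta> j" using vw by (simp add: words_def)
      next
        fix i assume "i < k"
        have "(\<Sum>j<k. content n w (i,j)) = content n u i"
          unfolding ue by (rule content_fst[symmetric]) (simp add: w join_def vk)
        then show "(\<Sum>j<k. content n w (i,j)) = \<alpha> i" using uw by (simp add: words_def)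
      qed
      moreover have "w \<in> fixed_words n (content n w) g"
      proof -
        have "\<forall>x\<in>{1..n}. u (g x) = u x" "\<forall>x\<in>{1..n}. v (g x) = v x"
          using u v by (auto simp: fixed_words_def fun_eq_iff)
        then have "w \<circ> g = w" unfolding fixed using gin by (auto simp: w join_def)
        moreover have "w \<in> extensional {1..n}" by (simp add: w join_def)
        ultimately show ?thesis by (simp add: fixed_words_def words_def)
      qed
      ultimately show "w \<in> (\<Union>A\<in>?M. fixed_words n A g)" by blast
    qed
    show "split ` (\<Union>A\<in>?M. fixed_words n A g) \<subseteq> fixed_words n \<alpha> g \<times> fixed_words n \<beta> g"
    proof
      fix p assume "p \<in> split ` (\<Union>A\<in>?M. fixed_words n A g)"
      then obtain w A where A: "A \<in> ?M" and w: "w \<in> fixed_words n A g" and p: "p = split w" by auto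
      have ww: "w \<in> words n A" using w by (simp add: fixed_words_def)
      have cA: "content n w = A" using ww by (simp add: words_def)
      have A0: "A (i,j) = 0" if "\<not> i < k \<or> \<not> j < k" for i j
        using A that by (auto simp: margin_matrices_def column_matrices_def)
      have "content n (\<lambda>x\<in>{1..n}. fst (w x)) i = \<alpha> i" for i
      proof -
        have "content n (\<lambda>x\<in>{1..n}. fst (w x)) i = (\<Sum>j<k. A (i,j))"
          unfolding cA[symmetric] by (rule content_fst) (use small[OF ww A] in blast)
        also have "\<dots> = \<alpha> i" using A A0[of i] \<alpha>[of i]
          by (cases "i < k") (auto simp: margin_matrices_def)
        finally show ?thesis .
      qed
      moreover have "content n (\<lambda>x\<in>{1..n}. snd (w x)) j = \<beta> j" for j
      proof -
        have "content n (\<lambda>x\<in>{1..n}. snd (w x)) j = (\<Sum>i<k. A (i,j))"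
          unfolding cA[symmetric] by (rule content_snd) (use small[OF ww A] in blast)
        also have "\<dots> = \<beta> j" using A A0[of _ j] \<beta>[of j]
          by (cases "j < k") (auto simp: margin_matrices_def column_matrices_def)
        finally show ?thesis .
      qed
      moreover have "\<forall>x\<in>{1..n}. w (g x) = w x" using w by (auto simp: fixed_words_def fun_eq_iff)
      then have "(\<lambda>x\<in>{1..n}. fst (w x)) \<circ> g = (\<lambda>x\<in>{1..n}. fst (w x))"
        "(\<lambda>x\<in>{1..n}. snd (w x)) \<circ> g = (\<lambda>x\<in>{1..n}. snd (w x))"
        unfolding fixed using gin by auto
      ultimately show "p \<in> fixed_words n \<alpha> g \<times> fixed_words n \<beta> g"
        by (auto simp: p split_def fixed_words_def words_def)
    qed
  qed
  then have "card (fixed_words n \<alpha> g \<times> fixed_words n \<beta> g) = card (\<Union>A\<in>?M. fixed_words n A g)"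
    by (rule bij_betw_same_card)
  also have "\<dots> = (\<Sum>A\<in>?M. card (fixed_words n A g))"
  proof (rule card_UN_disjoint)
    show "finite ?M"
      by (rule finite_subset[OF _ finite_column_matrices[of "{..<k}" k \<beta>]]) (auto simp: margin_matrices_def)
    show "\<forall>A\<in>?M. finite (fixed_words n A g)" by (auto simp: fixed_words_def finite_words)
    show "\<forall>A\<in>?M. \<forall>B\<in>?M. A \<noteq> B \<longrightarrow> fixed_words n A g \<inter> fixed_words n B g = {}"
      by (auto simp: fixed_words_def words_def)
  qed
  finally show ?thesis by (simp add: card_cartesian_product)
qed

text \<open>After exchanging the sums, Burnside's lemma gives \<open>fact n\<close> for each matrix.
  Words with that content exist because the entries of the matrix add up to
  \<open>n\<close>.\<close>

lemma sum_fixed_words_product: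
  assumes \<alpha>: "\<And>i. i \<ge> k \<Longrightarrow> \<alpha> i = 0" and \<beta>: "\<And>i. i \<ge> k \<Longrightarrow> \<beta> i = 0" and n: "(\<Sum>j<k. \<beta> j) = n"
  shows "(\<Sum>g\<in>carrier (sym_group n). card (fixed_words n \<alpha> g) * card (fixed_words n \<beta> g))
    = fact n * card (margin_matrices k \<alpha> \<beta>)"
proof -
  let ?M = "margin_matrices k \<alpha> \<beta>"
  have ne: "words n A \<noteq> {}" if A: "A \<in> ?M" for A
  proof (rule words_nonempty)
    show "finite ({..<k} \<times> {..<k})" by simp
    show "A c = 0" if "c \<notin> {..<k} \<times> {..<k}" for c
      using A that by (cases c) (auto simp: margin_matrices_def column_matrices_def)
    have "sum A ({..<k} \<times> {..<k}) = (\<Sum>j<k. \<Sum>i<k. A (i,j))"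
      by (subst sum.swap) (simp add: sum.cartesian_product)
    also have "\<dots> = (\<Sum>j<k. \<beta> j)" using A by (simp add: margin_matrices_def column_matrices_def)
    finally show "sum A ({..<k} \<times> {..<k}) = n" using n by simp
  qed
  have "(\<Sum>g\<in>carrier (sym_group n). card (fixed_words n \<alpha> g) * card (fixed_words n \<beta> g))
      = (\<Sum>g\<in>carrier (sym_group n). \<Sum>A\<in>?M. card (fixed_words n A g))"
    using card_fixed_words_product[OF _ \<alpha> \<beta>] by (intro sum.cong) (auto simp: sym_group_carrier)
  also have "\<dots> = (\<Sum>A\<in>?M. \<Sum>g\<in>carrier (sym_group n). card (fixed_words n A g))"
    by (rule sum.swap)
  also have "\<dots> = (\<Sum>A\<in>?M. fact n)" using sum_card_fixed_words[OF ne] by simp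
  finally show ?thesis by simp
qed

text \<open>The composition \<open>\<lambda> + \<delta> - v \<delta>\<close> for \<open>\<lambda> = (k, \<dots>, k)\<close> and \<open>\<delta> = (0, \<dots>, k - 1)\<close>.\<close>

definition frobenius_exponents :: "nat \<Rightarrow> (nat \<Rightarrow> nat) \<Rightarrow> nat \<Rightarrow> nat"
  where "frobenius_exponents k v i = (if i < k then k + i - v i else 0)"

text \<open>The Jacobi-Trudi determinant of the \<open>h\<close> with index
  \<open>k + i - j\<close>, expanded over permutations, each product of \<open>h\<close> being read
  as the permutation character on words.\<close>

definition square_character :: "nat \<Rightarrow> (nat \<Rightarrow> nat) \<Rightarrow> int"
  where "square_character k g = (\<Sum>v | v permutes {..<k}.
    sign v * int (card (fixed_words (k * k) (frobenius_exponents k v) g)))"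

text \<open>The subtraction on natural numbers never truncates, because
  \<open>v i < k \<le> k + i\<close>.\<close>

lemma frobenius_exponents_add:
  assumes "v permutes {..<k}" "i < k"
  shows "v i + frobenius_exponents k v i = k + i"
  using permutes_in_image[OF assms(1), of i] assms(2) by (simp add: frobenius_exponents_def)

lemma sum_frobenius_exponents:
  assumes "v permutes {..<k}"
  shows "(\<Sum>i<k. frobenius_exponents k v i) = k * k"
proof -
  have "(\<Sum>i<k. v i) + (\<Sum>i<k. frobenius_exponents k v i) = (\<Sum>i<k. k + i)"
    unfolding sum.distrib[symmetric] using frobenius_exponents_add[OF assms] by simp
  moreover have "(\<Sum>i<k. v i) = (\<Sum>i<k. i)" using sum.permute[OF assms, of "\<lambda>i. i"] by (simp add: o_def)
  ultimately show ?thesis by (simp add: sum.distrib)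
qed

lemma frobenius_exponents_const:
  assumes "v permutes {..<k}"
  shows "(\<forall>i<k. frobenius_exponents k v i = k) \<longleftrightarrow> v = id"
proof
  assume *: "\<forall>i<k. frobenius_exponents k v i = k"
  have "v i = i" for i
    using frobenius_exponents_add[OF assms, of i] * permutes_not_in[OF assms, of i] by (cases "i < k") auto
  then show "v = id" by auto
qed (simp add: frobenius_exponents_def)

text \<open>The row condition \<open>v i + s = k + i\<close> of the shifted matrices says that row
  \<open>i\<close> has sum \<open>frobenius_exponents k v i\<close>. Hence the alternating sum over
  \<open>v\<close> is the signed count for the square.\<close>

lemma sum_sign_margin_matrices:
  assumes "(\<Sum>j<k. \<beta> j) = k * k"
  shows "(\<Sum>v | v permutes {..<k}. sign v * int (card (margin_matrices k (frobenius_exponents k v) \<beta>)))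
    = (if \<forall>j<k. \<beta> j = k then 1 else 0)"
proof -
  have fin: "finite (margin_matrices k \<alpha> \<beta>)" for \<alpha>
    by (rule finite_subset[OF _ finite_column_matrices[of "{..<k}" k \<beta>]]) (auto simp: margin_matrices_def)
  have eq: "v i + s = k + i \<longleftrightarrow> s = frobenius_exponents k v i" if "v permutes {..<k}" "i < k" for v i s
    using frobenius_exponents_add[OF that] by auto
  have sh: "shifted_matrices k {..<k} \<beta> (\<lambda>i. k + i)
      = Sigma {v. v permutes {..<k}} (\<lambda>v. margin_matrices k (frobenius_exponents k v) \<beta>)"
    by (auto simp: shifted_matrices_def margin_matrices_def eq)
  have "signed_count k {..<k} \<beta> (\<lambda>i. k + i)
      = (\<Sum>v | v permutes {..<k}. \<Sum>A\<in>margin_matrices k (frobenius_exponents k v) \<beta>. sign v)"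
    unfolding signed_count_def sh by (rule sum.Sigma[symmetric]) (auto simp: fin finite_permutations)
  then show ?thesis using signed_count_square[OF assms] by (simp add: mult.commute)
qed

lemma square_character_norm:
  "(\<Sum>g\<in>carrier (sym_group (k * k)). square_character k g * square_character k g) = fact (k * k)"
proof -
  let ?P = "{v. v permutes {..<k}}" and ?G = "carrier (sym_group (k * k))"
  let ?x = "frobenius_exponents k"
  let ?f = "\<lambda>v g. int (card (fixed_words (k * k) (?x v) g))"
  have "(\<Sum>g\<in>?G. square_character k g * square_character k g)
      = (\<Sum>g\<in>?G. \<Sum>w\<in>?P. \<Sum>v\<in>?P. sign w * (sign v * (?f v g * ?f w g)))"
    unfolding square_character_def sum_product by (intro sum.cong refl) (simp add: mult_ac)
  also have "\<dots> = (\<Sum>w\<in>?P. \<Sum>g\<in>?G. \<Sum>v\<in>?P. sign w * (sign v * (?f v g * ?f w g)))"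
    by (rule sum.swap)
  also have "\<dots> = (\<Sum>w\<in>?P. \<Sum>v\<in>?P. \<Sum>g\<in>?G. sign w * (sign v * (?f v g * ?f w g)))"
    by (rule sum.cong[OF refl sum.swap])
  also have "\<dots> = (\<Sum>w\<in>?P. \<Sum>v\<in>?P. sign w * (sign v * (fact (k * k) * int (card (margin_matrices k (?x v) (?x w))))))"
  proof (intro sum.cong refl)
    fix w v assume "w \<in> ?P" "v \<in> ?P"
    then have "(\<Sum>g\<in>?G. card (fixed_words (k * k) (?x v) g) * card (fixed_words (k * k) (?x w) g))
        = fact (k * k) * card (margin_matrices k (?x v) (?x w))"
      by (intro sum_fixed_words_product) (auto simp: sum_frobenius_exponents, auto simp: frobenius_exponents_def)
    from arg_cong[OF this, of int]
    have "(\<Sum>g\<in>?G. ?f v g * ?f w g) = fact (k * k) * int (card (margin_matrices k (?x v) (?x w)))"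
      by simp
    then show "(\<Sum>g\<in>?G. sign w * (sign v * (?f v g * ?f w g)))
        = sign w * (sign v * (fact (k * k) * int (card (margin_matrices k (?x v) (?x w)))))"
      by (simp add: sum_distrib_left[symmetric])
  qed
  also have "\<dots> = fact (k * k) * (\<Sum>w\<in>?P. sign w *
      (\<Sum>v\<in>?P. sign v * int (card (margin_matrices k (?x v) (?x w)))))"
    unfolding sum_distrib_left by (intro sum.cong refl) (simp add: mult_ac)
  also have "(\<Sum>w\<in>?P. sign w * (\<Sum>v\<in>?P. sign v * int (card (margin_matrices k (?x v) (?x w)))))
      = (\<Sum>w\<in>?P. if w = id then 1 else 0)"
  proof (intro sum.cong refl)
    fix w assume "w \<in> ?P"
    then have w: "w permutes {..<k}" by simp
    show "sign w * (\<Sum>v\<in>?P. sign v * int (card (margin_matrices k (?x v) (?x w)))) = (if w = id then 1 else 0)"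
      unfolding sum_sign_margin_matrices[OF sum_frobenius_exponents[OF w]] frobenius_exponents_const[OF w]
      by simp
  qed
  also have "\<dots> = 1" by (simp add: finite_permutations permutes_id)
  finally show ?thesis by simp
qed

text \<open>The norm determines the irreducible character only up to sign, which is why the
  conclusion speaks of absolute values.\<close>

lemma square_character_irreducible:
  obtains \<chi> where "irreducible_character (sym_group (k * k)) \<chi>"
    "\<And>g. g \<in> carrier (sym_group (k * k)) \<Longrightarrow> cmod (\<chi> g) = of_int \<bar>square_character k g\<bar>"
proof -
  let ?G = "sym_group (k * k)" and ?P = "{v. v permutes {..<k}}"
  let ?f = "\<lambda>g. of_int (square_character k g) :: complex"
  have fin: "finite (carrier ?G)"
    using finite_permutations[of "{1..k * k}"] by (simp add: sym_group_def)
  have "virtual_character ?G (\<lambda>g. of_nat (card (fixed_words (k * k) \<alpha> g)))" for \<alpha> :: "nat \<Rightarrow> nat"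
    using permutation_character_virtual[OF word_action finite_words, of "k * k" \<alpha>]
    by (rule virtual_character_cong) (simp add: sym_group_carrier invariants_word_action)
  then have "virtual_character ?G (\<lambda>g. \<Sum>v\<in>?P. of_int (sign v) *
      of_nat (card (fixed_words (k * k) (frobenius_exponents k v) g)))"
    by (intro virtual_character_sum virtual_character_scale)
  then have virt: "virtual_character ?G ?f"
    by (rule virtual_character_cong) (simp add: square_character_def)
  \<comment> \<open>A permutation and its inverse fix the same words, so the pairing is the sum of
    squares computed before.\<close>
  have "(\<Sum>g\<in>carrier ?G. ?f g * ?f (inv\<^bsub>?G\<^esub> g)) = (\<Sum>g\<in>carrier ?G. ?f g * ?f g)"
    by (intro sum.cong refl) (simp add: square_character_def fixed_words_inv sym_group_carrier)
  also have "\<dots> = of_int (\<Sum>g\<in>carrier ?G. square_character k g * square_character k g)" by simp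
  also have "\<dots> = of_nat (card (carrier ?G))"
    unfolding square_character_norm by (simp add: sym_group_card_carrier)
  finally have norm: "(\<Sum>g\<in>carrier ?G. ?f g * ?f (inv\<^bsub>?G\<^esub> g)) = of_nat (card (carrier ?G))" .
  obtain \<chi> and s :: int where \<chi>: "irreducible_character ?G \<chi>" and s: "\<bar>s\<bar> = 1"
    and f: "\<And>g. g \<in> carrier ?G \<Longrightarrow> ?f g = of_int s * \<chi> g"
    using virtual_character_norm_one[OF sym_group_is_group fin virt norm] by blast
  have "cmod (\<chi> g) = of_int \<bar>square_character k g\<bar>" if "g \<in> carrier ?G" for g
  proof -
    have "cmod (of_int s) = of_int \<bar>s\<bar>" by simp
    then have "cmod (of_int s * \<chi> g) = cmod (\<chi> g)" using s by (simp add: norm_mult)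
    then show ?thesis unfolding f[OF that, symmetric] by simp
  qed
  then show thesis using that \<chi> by blast
qed

section \<open>The value at a product of cycles\<close>

text \<open>Points are written \<open>x = q * k + r + 1\<close> with block \<open>q\<close> and
  offset \<open>r\<close>, the final 1 because they start at 1; each block is rotated by one
  offset.\<close>

definition block_rotation :: "nat \<Rightarrow> nat \<Rightarrow> nat"
  where "block_rotation k x = (if x \<in> {1..k * k} then (x - 1) div k * k + Suc ((x - 1) mod k) mod k + 1 else x)"

context
  fixes k :: nat
  assumes k: "k \<ge> 1"
begin

lemma block_point:
  assumes "q < k" "r < k"
  shows "q * k + r + 1 \<in> {1..k * k}" "(q * k + r) div k = q" "(q * k + r) mod k = r"
proof -
  have "q * k + r < Suc q * k" using assms by simp
  also have "\<dots> \<le> k * k" using assms by (intro mult_le_mono1) simp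
  finally show "q * k + r + 1 \<in> {1..k * k}" by simp
qed (use assms in auto)

lemma block_coordinates:
  assumes "x \<in> {1..k * k}"
  obtains q r where "q < k" "r < k" "x = q * k + r + 1" "(x - 1) div k = q"
proof
  have "x - 1 < k * k" using assms by auto
  then show "(x - 1) div k < k" using k by (simp add: less_mult_imp_div_less)
  show "(x - 1) mod k < k" using k by simp
  show "x = (x - 1) div k * k + (x - 1) mod k + 1" using assms by simp
qed (rule refl)

lemma block_rotation_power:
  assumes "q < k" "r < k"
  shows "(block_rotation k ^^ i) (q * k + r + 1) = q * k + (r + i) mod k + 1"
proof (induction i)
  case (Suc i)
  have m: "(r + i) mod k < k" using k by simp
  have "(block_rotation k ^^ Suc i) (q * k + r + 1) = block_rotation k (q * k + (r + i) mod k + 1)"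
    by (simp add: Suc[simplified])
  also have "\<dots> = q * k + Suc ((r + i) mod k) mod k + 1"
    using block_point[OF assms(1) m] by (simp add: block_rotation_def)
  finally show ?case by (simp add: mod_Suc_eq)
qed (use assms in simp)

lemma block_rotation_same_block:
  assumes "x \<in> {1..k * k}"
  shows "block_rotation k x \<in> {1..k * k}" "(block_rotation k x - 1) div k = (x - 1) div k"
proof -
  obtain q r where *: "q < k" "r < k" "x = q * k + r + 1" "(x - 1) div k = q"
    using block_coordinates[OF assms] by blast
  have m: "Suc r mod k < k" using k by simp
  have "block_rotation k x = q * k + Suc r mod k + 1"
    using block_rotation_power[OF *(1,2), of 1] *(3) by simp
  then show "block_rotation k x \<in> {1..k * k}" "(block_rotation k x - 1) div k = (x - 1) div k"
    using block_point[OF *(1) m] *(4) by auto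
qed

lemma block_rotation_power_k:
  assumes "x \<in> {1..k * k}"
  shows "(block_rotation k ^^ k) x = x"
proof -
  obtain q r where *: "q < k" "r < k" "x = q * k + r + 1"
    using block_coordinates[OF assms] by blast
  show ?thesis using block_rotation_power[OF *(1,2), of k] *(2) by (simp add: *(3))
qed

lemma block_rotation_permutes: "block_rotation k permutes {1..k * k}"
proof (rule bij_imp_permutes)
  let ?g = "block_rotation k" and ?S = "{1..k * k}"
  have k': "k = Suc (k - 1)" using k by simp
  have "inj_on ?g ?S"
  proof (rule inj_onI)
    fix x y assume xy: "x \<in> ?S" "y \<in> ?S" "?g x = ?g y"
    \<comment> \<open>Injectivity follows because the \<open>k\<close>-th power is the identity on
      the points; \<open>k \<ge> 1\<close> lets the first factor of the power be split off.\<close>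
    have "(?g ^^ Suc (k - 1)) x = (?g ^^ Suc (k - 1)) y"
      unfolding funpow_Suc_right comp_apply xy(3) ..
    then have "(?g ^^ k) x = (?g ^^ k) y" using k' by simp
    then show "x = y" by (simp only: block_rotation_power_k[OF xy(1)] block_rotation_power_k[OF xy(2)])
  qed
  moreover have "?g ` ?S \<subseteq> ?S" using block_rotation_same_block(1) by blast
  ultimately show "bij_betw ?g ?S ?S" by (simp add: bij_betw_def endo_inj_surj)
  show "?g x = x" if "x \<notin> ?S" for x using that by (simp only: block_rotation_def if_False)
qed

lemma block_rotation_transitive:
  assumes x: "x \<in> {1..k * k}" and y: "y \<in> {1..k * k}" and eq: "(x - 1) div k = (y - 1) div k"
  obtains i where "y = (block_rotation k ^^ i) x"
proof -
  obtain q r where *: "q < k" "r < k" "x = q * k + r + 1" "(x - 1) div k = q"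
    using block_coordinates[OF x] by blast
  obtain q' s where s: "q' < k" "s < k" "y = q' * k + s + 1" "(y - 1) div k = q'"
    using block_coordinates[OF y] by blast
  have "q' = q" using eq * s by simp
  then have y': "y = q * k + s + 1" using s by simp
  \<comment> \<open>The offset must change by \<open>s - r\<close>, which may be negative; adding a
    full turn \<open>k\<close> keeps the exponent a natural number.\<close>
  have "(block_rotation k ^^ (k - r + s)) x = q * k + (r + (k - r + s)) mod k + 1"
    unfolding *(3) by (rule block_rotation_power[OF *(1,2)])
  also have "\<dots> = y" unfolding y' using *(2) s(2) by simp
  finally show thesis using that by metis
qed

lemma card_cyclic_orbits_block_rotation: "card (cyclic_orbits (k * k) (block_rotation k)) = k"
proof -
  let ?g = "block_rotation k" and ?G = "sym_group (k * k)" and ?S = "{1..k * k}"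
  let ?B = "\<lambda>q. {y\<in>?S. (y - 1) div k = q}"
  \<comment> \<open>No element of the cyclic group leaves a block, so each orbit lies in a block.
    Conversely the powers of the rotation, which \<open>pow\<close> places in the group, reach the
    whole block.\<close>
  have pres: "p permutes ?S \<and> (\<forall>x\<in>?S. (p x - 1) div k = (x - 1) div k)"
    if "p \<in> generate ?G {?g}" for p
    using that
  proof (induction rule: generate.induct)
    case one
    show ?case by (simp add: sym_group_one permutes_def)
  next
    case (incl h)
    then show ?case using block_rotation_permutes block_rotation_same_block(2) by simp
  next
    case (inv h)
    have g: "?g permutes ?S" by (rule block_rotation_permutes)
    have "(inv' ?g x - 1) div k = (x - 1) div k" if "x \<in> ?S" for x
    proof -
      have "inv' ?g x \<in> ?S" using permutes_in_image[OF permutes_inv[OF g]] that by blast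
      from block_rotation_same_block(2)[OF this] show ?thesis by (simp only: permutes_inverses(1)[OF g])
    qed
    moreover have "inv\<^bsub>?G\<^esub> h = inv' ?g" using inv g by (simp add: sym_group_carrier)
    ultimately show ?case using permutes_inv[OF g] by metis
  next
    case (eng h1 h2)
    have "h2 x \<in> ?S" if "x \<in> ?S" for x using permutes_in_image[of h2 ?S x] eng.IH(2) that by blast
    then have "\<forall>x\<in>?S. ((h1 \<circ> h2) x - 1) div k = (x - 1) div k" using eng.IH by (metis comp_apply)
    moreover have "h1 \<circ> h2 permutes ?S" using eng.IH permutes_compose by blast
    ultimately show ?case by (simp only: sym_group_mult simp_thms)
  qed
  have pow: "?g ^^ i \<in> generate ?G {?g}" for i
  proof (induction i)
    case 0
    show ?case using generate.one[of ?G "{?g}"] by (simp add: sym_group_one id_def)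
  next
    case (Suc i)
    show ?case using generate.eng[OF generate.incl[OF singletonI] Suc]
      by (simp only: sym_group_mult funpow.simps)
  qed
  have orb: "orbit (?G\<lparr>carrier := generate ?G {?g}\<rparr>) (\<lambda>p. p) x = ?B ((x - 1) div k)" if x: "x \<in> ?S" for x
  proof (intro equalityI subsetI)
    fix y assume "y \<in> orbit (?G\<lparr>carrier := generate ?G {?g}\<rparr>) (\<lambda>p. p) x"
    then obtain p where p: "p \<in> generate ?G {?g}" "y = p x" by (auto simp: orbit_def)
    then have "y \<in> ?S" using pres[OF p(1)] permutes_in_image[of p ?S x] x by blast
    then show "y \<in> ?B ((x - 1) div k)" using pres[OF p(1)] p(2) x by blast
  next
    fix y assume "y \<in> ?B ((x - 1) div k)"
    then have y: "y \<in> ?S" "(x - 1) div k = (y - 1) div k" by auto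
    obtain i where "y = (?g ^^ i) x" using block_rotation_transitive[OF x y] by blast
    then show "y \<in> orbit (?G\<lparr>carrier := generate ?G {?g}\<rparr>) (\<lambda>p. p) x"
      using pow[of i] by (auto simp: orbit_def)
  qed
  have img: "(\<lambda>x. (x - 1) div k) ` ?S = {..<k}"
  proof (intro equalityI subsetI)
    fix q assume "q \<in> (\<lambda>x. (x - 1) div k) ` ?S"
    then show "q \<in> {..<k}" using block_coordinates by force
  next
    fix q assume "q \<in> {..<k}"
    then show "q \<in> (\<lambda>x. (x - 1) div k) ` ?S"
      using block_point[of q 0] k by (intro image_eqI[of _ _ "q * k + 0 + 1"]) auto
  qed
  have "cyclic_orbits (k * k) ?g = (\<lambda>x. ?B ((x - 1) div k)) ` ?S"
    unfolding cyclic_orbits_def orbits_def Setcompr_eq_image by (rule image_cong[OF refl orb])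
  also have "\<dots> = ?B ` {..<k}" unfolding img[symmetric] by (simp add: image_image)
  finally have "cyclic_orbits (k * k) ?g = ?B ` {..<k}" .
  moreover have "inj_on ?B {..<k}"
  proof (rule inj_onI)
    fix p q assume p: "p \<in> {..<k}" and eq: "?B p = ?B q"
    have "p * k + 0 + 1 \<in> ?B p" using block_point[of p 0] p k by auto
    then have "p * k + 0 + 1 \<in> ?B q" unfolding eq .
    then show "p = q" using k by simp
  qed
  ultimately show ?thesis by (simp add: card_image)
qed

section \<open>Words fixed by the block rotation\<close>

lemma fixed_word_block_constant:
  assumes w: "w \<circ> block_rotation k = w" and x: "x \<in> {1..k * k}"
  shows "w x = w ((x - 1) div k * k + 1)"
proof -
  obtain q r where *: "q < k" "r < k" "x = q * k + r + 1" "(x - 1) div k = q"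
    using block_coordinates[OF x] by blast
  have pow: "w ((block_rotation k ^^ i) y) = w y" for i y
    using w by (induction i) (auto simp: fun_eq_iff)
  have "(block_rotation k ^^ r) (q * k + 1) = x"
    using block_rotation_power[of q 0 r] * k by simp
  then show ?thesis using pow[of r "q * k + 1"] *(4) by simp
qed

text \<open>\<open>h\<close> gives the letter of each block, and a block contributes
  \<open>k\<close> positions to the count of its letter. Hence the divisibility of the content by
  \<open>k\<close>.\<close>

lemma content_blocks:
  assumes "\<And>x. x \<in> {1..k * k} \<Longrightarrow> w x = h ((x - 1) div k)"
  shows "content (k * k) w c = card {q. q < k \<and> h q = c} * k"
proof -
  have "bij_betw (\<lambda>(q,r). q * k + r + 1) ({q. q < k \<and> h q = c} \<times> {..<k}) {x\<in>{1..k * k}. w x = c}"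
  proof (rule bij_betw_byWitness[where f' = "\<lambda>x. ((x - 1) div k, (x - 1) mod k)"])
    show "(\<lambda>(q,r). q * k + r + 1) ` ({q. q < k \<and> h q = c} \<times> {..<k}) \<subseteq> {x\<in>{1..k * k}. w x = c}"
    proof
      fix x assume "x \<in> (\<lambda>(q,r). q * k + r + 1) ` ({q. q < k \<and> h q = c} \<times> {..<k})"
      then obtain q r where *: "x = q * k + r + 1" "q < k" "h q = c" "r < k" by auto
      then show "x \<in> {x\<in>{1..k * k}. w x = c}"
        using block_point[OF *(2,4)] assms[of x] by auto
    qed
    show "(\<lambda>x. ((x - 1) div k, (x - 1) mod k)) ` {x\<in>{1..k * k}. w x = c} \<subseteq> {q. q < k \<and> h q = c} \<times> {..<k}"
    proof
      fix p assume "p \<in> (\<lambda>x. ((x - 1) div k, (x - 1) mod k)) ` {x\<in>{1..k * k}. w x = c}"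
      then obtain x where x: "x \<in> {1..k * k}" "w x = c" "p = ((x - 1) div k, (x - 1) mod k)" by auto
      then show "p \<in> {q. q < k \<and> h q = c} \<times> {..<k}"
        using block_coordinates[OF x(1)] assms[OF x(1)] k by fastforce
    qed
  qed (use block_point in auto)
  from bij_betw_same_card[OF this] show ?thesis by (simp add: content_def card_cartesian_product)
qed

lemma card_fixed_words_block_rotation:
  assumes v: "v permutes {..<k}"
  shows "card (fixed_words (k * k) (frobenius_exponents k v) (block_rotation k)) = (if v = id then fact k else 0)"
proof -
  let ?g = "block_rotation k" and ?S = "{1..k * k}"
  let ?F = "fixed_words (k * k) (frobenius_exponents k v) ?g"
  \<comment> \<open>The letter of block \<open>q\<close> is read off at its first point. The default
    \<open>q\<close> outside the blocks makes \<open>h w\<close> a permutation in the sense of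
    \<open>permutes\<close> once it is bijective on \<open>{..<k}\<close>.\<close>
  define h where "h w = (\<lambda>q. if q < k then w (q * k + 1) else q)" for w :: "nat \<Rightarrow> nat"
  have blk: "(x - 1) div k < k" if "x \<in> ?S" for x using block_coordinates[OF that] by metis
  have wh: "w x = h w ((x - 1) div k)" if "w \<in> ?F" "x \<in> ?S" for w x
    using fixed_word_block_constant[of w x] that blk[OF that(2)] by (simp add: h_def fixed_words_def)
  have fib: "frobenius_exponents k v c = card {q. q < k \<and> h w q = c} * k" if "w \<in> ?F" for w c
  proof -
    have "content (k * k) w = frobenius_exponents k v" using that by (simp add: fixed_words_def words_def)
    then show ?thesis using content_blocks[of w "h w" c] wh[OF that] by simp
  qed
  have one: "card {q. q < k \<and> h w q = c} = 1" if w: "w \<in> ?F" and c: "c < k" for w c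
  proof -
    let ?m = "card {q. q < k \<and> h w q = c}"
    have "v c < k" using permutes_in_image[OF v, of c] c by simp
    moreover have "v c + ?m * k = k + c" using frobenius_exponents_add[OF v c] fib[OF w] by simp
    \<comment> \<open>Since \<open>?m * k = k + c - v c\<close> and both \<open>c\<close> and
      \<open>v c\<close> are below \<open>k\<close>, the multiple is exactly \<open>k\<close>: each
      letter below \<open>k\<close> fills one block.\<close>
    ultimately have "0 < ?m * k" "?m * k < 2 * k" using c by linarith+
    then show ?thesis by simp
  qed
  show ?thesis
  proof (cases "v = id")
    case False
    have "?F = {}"
    proof (rule equals0I)
      fix w assume w: "w \<in> ?F"
      have "\<forall>c<k. frobenius_exponents k v c = k" using fib[OF w] one[OF w] by simp
      then show False using frobenius_exponents_const[OF v] False by simp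
    qed
    then show ?thesis using False by simp
  next
    case True
    \<comment> \<open>For the identity every letter is used on exactly one block, so fixed words
      correspond to bijections between blocks and letters. This is the origin of the
      factorial.\<close>
    have "bij_betw h ?F {p. p permutes {..<k}}"
    proof (rule bij_betw_byWitness[where f' = "\<lambda>p. \<lambda>x\<in>?S. p ((x - 1) div k)"])
      show "\<forall>w\<in>?F. (\<lambda>x\<in>?S. h w ((x - 1) div k)) = w"
      proof
        fix w assume w: "w \<in> ?F"
        have wext: "w \<in> extensional ?S" using w by (simp add: fixed_words_def words_def)
        have pt: "(\<lambda>x\<in>?S. h w ((x - 1) div k)) x = w x" for x
        proof (cases "x \<in> ?S")
          case True
          then show ?thesis by (simp only: restrict_apply if_True wh[OF w True])
        next
          case False
          then show ?thesis by (simp only: restrict_apply if_False extensional_arb[OF wext False])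
        qed
        show "(\<lambda>x\<in>?S. h w ((x - 1) div k)) = w" by (rule ext) (rule pt)
      qed
      show "\<forall>p\<in>{p. p permutes {..<k}}. h (\<lambda>x\<in>?S. p ((x - 1) div k)) = p"
      proof
        fix p assume "p \<in> {p. p permutes {..<k}}"
        then have p: "p permutes {..<k}" by simp
        have "h (\<lambda>x\<in>?S. p ((x - 1) div k)) q = p q" for q
          using block_point[of q 0] k permutes_not_in[OF p, of q] by (cases "q < k") (auto simp: h_def)
        then show "h (\<lambda>x\<in>?S. p ((x - 1) div k)) = p" by (rule ext)
      qed
      show "h ` ?F \<subseteq> {p. p permutes {..<k}}"
      proof
        fix p assume "p \<in> h ` ?F"
        then obtain w where w: "w \<in> ?F" and p: "p = h w" by blast
        have "{..<k} \<subseteq> p ` {..<k}"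
        proof
          fix c assume "c \<in> {..<k}"
          then have "card {q. q < k \<and> h w q = c} = 1" using one[OF w] by simp
          then have "{q. q < k \<and> h w q = c} \<noteq> {}" by (metis card.empty zero_neq_one)
          then show "c \<in> p ` {..<k}" by (auto simp: p)
        qed
        moreover have "p ` {..<k} \<subseteq> {..<k}"
        proof
          fix c assume "c \<in> p ` {..<k}"
          then obtain q where q: "q < k" "c = h w q" by (auto simp: p)
          then have "{q. q < k \<and> h w q = c} \<noteq> {}" by blast
          then have "card {q. q < k \<and> h w q = c} \<noteq> 0" by simp
          then have "frobenius_exponents k v c \<noteq> 0" using fib[OF w] k by simp
          then show "c \<in> {..<k}" by (auto simp: frobenius_exponents_def split: if_splits)
        qed
        ultimately have "p ` {..<k} = {..<k}" by (rule equalityI[rotated])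
        then have "bij_betw p {..<k} {..<k}" by (simp add: bij_betw_def eq_card_imp_inj_on)
        then have "p permutes {..<k}" by (rule bij_imp_permutes) (simp add: p h_def)
        then show "p \<in> {p. p permutes {..<k}}" by simp
      qed
      show "(\<lambda>p. \<lambda>x\<in>?S. p ((x - 1) div k)) ` {p. p permutes {..<k}} \<subseteq> ?F"
      proof
        fix w assume "w \<in> (\<lambda>p. \<lambda>x\<in>?S. p ((x - 1) div k)) ` {p. p permutes {..<k}}"
        then obtain p where p: "p permutes {..<k}" and w: "w = (\<lambda>x\<in>?S. p ((x - 1) div k))" by auto
        have "content (k * k) w c = frobenius_exponents k v c" for c
        proof -
          have "{q. q < k \<and> p q = c} = (if c < k then {inv' p c} else {})"
            using permutes_in_image[OF p] permutes_inverses[OF p] permutes_in_image[OF permutes_inv[OF p]]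
            by (auto split: if_splits)
          moreover have "content (k * k) w c = card {q. q < k \<and> p q = c} * k"
            by (rule content_blocks) (simp add: w)
          ultimately show ?thesis using True by (simp add: frobenius_exponents_def)
        qed
        then have "content (k * k) w = frobenius_exponents k v" by (rule ext)
        moreover have "w \<in> extensional ?S" by (simp add: w)
        moreover have "(w \<circ> ?g) x = w x" for x
        proof (cases "x \<in> ?S")
          case True
          then show ?thesis using block_rotation_same_block[OF True] by (simp add: w)
        next
          case False
          then show ?thesis using permutes_not_in[OF block_rotation_permutes, of x] by simp
        qed
        then have "w \<circ> ?g = w" by (rule ext)
        ultimately show "w \<in> ?F" by (simp add: fixed_words_def words_def)
      qed
    qed
    then have "card ?F = card {p. p permutes {..<k}}" by (rule bij_betw_same_card)
    then show ?thesis using True by (simp add: card_permutations)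
  qed
qed

lemma square_character_block_rotation: "square_character k (block_rotation k) = fact k"
proof -
  have "square_character k (block_rotation k) = (\<Sum>v | v permutes {..<k}. if v = id then fact k else 0)"
    unfolding square_character_def
    by (intro sum.cong refl) (simp add: card_fixed_words_block_rotation)
  then show ?thesis by (simp add: finite_permutations permutes_id)
qed

end

theorem theorem2:
  fixes k :: nat
  assumes "k \<ge> 1"
  shows "\<exists>(n::nat) g \<chi>. n > 0 \<and> g \<in> carrier (sym_group n) \<and>
           irreducible_character (sym_group n) \<chi> \<and>
           card (cyclic_orbits n g) = k \<and> cmod (\<chi> g) = fact k"
proof -
  obtain \<chi> where \<chi>: "irreducible_character (sym_group (k * k)) \<chi>"
    "\<And>g. g \<in> carrier (sym_group (k * k)) \<Longrightarrow> cmod (\<chi> g) = of_int \<bar>square_character k g\<bar>"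
    using square_character_irreducible by blast
  have g: "block_rotation k \<in> carrier (sym_group (k * k))"
    using block_rotation_permutes[OF assms] by (simp add: sym_group_carrier)
  have "cmod (\<chi> (block_rotation k)) = fact k"
    unfolding \<chi>(2)[OF g] square_character_block_rotation[OF assms] by simp
  then show ?thesis
    using g \<chi>(1) card_cyclic_orbits_block_rotation[OF assms] assms
    by (intro exI[of _ "k * k"] exI[of _ "block_rotation k"] exI[of _ \<chi>]) auto
qed

end
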